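(* Let $0<\tau<T$, $a_{+},a_{-}>0$, and let $a\in L^{\infty}(0,T)$ be the stepwise function $a(t)=a_{+}$ for $t\in[0,\tau)$ and $a(t)=-a_{-}$ for $t\in[\tau,T)$. Let $p>1$ and $$\gamma\in\left(-\infty,\frac{1-2p}{p-1}\right]\cup\left(p-1,+\infty\right).$$ Then the Neumann boundary value problem ($u'(0)=u'(T)=0$) and the periodic boundary value problem ($u(0)=u(T)$, $u'(0)=u'(T)$) associated with the equation $$\bigl(|u'|^{p-2}u'\bigr)'+a(t)u^{\gamma}=0$$ on $[0,T]$ each have at most one positive solution. Moreover, for each of these two problems, there exists a unique positive solution if and only if $\gamma\cdot\int_{0}^{T}a(t)\,\mathrm{d}t<0$.
   Context: A positive solution of $(|u'|^{p-2}u')'+a(t)u^{\gamma}=0$ is a function $u\colon[0,T]\to(0,+\infty)$ of class $\mathcal{C}^{1}$ such that $|u'|^{p-2}u'$ (understood as $0$ where $u'=0$) is absolutely continuous and the equation is satisfied for almost every $t\in[0,T]$ (in addition to the prescribed boundary conditions). *)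

theory Defs
  imports "HOL-Analysis.Analysis"
begin

(* A finite family of non-overlapping subintervals is encoded as the set D of its pairs of
   endpoints.  (The library constant absolutely_continuous concerns measures.) *)
definition absolutely_continuous_fun_on :: "(real \<Rightarrow> real) \<Rightarrow> real set \<Rightarrow> bool" where
  "absolutely_continuous_fun_on f S \<longleftrightarrow>
     (\<forall>\<epsilon>>0. \<exists>\<delta>>0. \<forall>D :: (real \<times> real) set.
        finite D \<and>
        (\<forall>(c, d)\<in>D. c < d \<and> {c..d} \<subseteq> S) \<and>
        pairwise (\<lambda>(c, d) (c', d'). {c<..<d} \<inter> {c'<..<d'} = {}) D \<and>
        (\<Sum>(c, d)\<in>D. d - c) < \<delta>
        \<longrightarrow> (\<Sum>(c, d)\<in>D. \<bar>f d - f c\<bar>) < \<epsilon>)"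

(* The value at s = 0 is 0 for every p. *)
definition phi :: "real \<Rightarrow> real \<Rightarrow> real" where
  "phi p s = \<bar>s\<bar> powr (p - 2) * s"

(* u is a positive solution on [0,T] whose derivative (one-sided at the endpoints) is u'.
   A function [0,T] -> (0,+oo) is an extensional one: it is arbitrary but fixed (undefined)
   outside [0,T], so that equality of solutions is equality on [0,T].
   Only the values of u' on [0,T] matter. *)
definition positive_solution ::
  "real \<Rightarrow> real \<Rightarrow> (real \<Rightarrow> real) \<Rightarrow> real \<Rightarrow> (real \<Rightarrow> real) \<Rightarrow> (real \<Rightarrow> real) \<Rightarrow> bool" where
  "positive_solution p \<gamma> a T u u' \<longleftrightarrow>
     u \<in> {0..T} \<rightarrow>\<^sub>E {0<..} \<and>
     (\<forall>t\<in>{0..T}. (u has_real_derivative u' t) (at t within {0..T})) \<and>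
     continuous_on {0..T} u' \<and>
     absolutely_continuous_fun_on (\<lambda>t. phi p (u' t)) {0..T} \<and>
     (AE t in lebesgue_on {0..T}. \<exists>D.
        ((\<lambda>s. phi p (u' s)) has_real_derivative D) (at t within {0..T}) \<and>
        D + a t * u t powr \<gamma> = 0)"

definition neumann_positive_solution ::
  "real \<Rightarrow> real \<Rightarrow> (real \<Rightarrow> real) \<Rightarrow> real \<Rightarrow> (real \<Rightarrow> real) \<Rightarrow> bool" where
  "neumann_positive_solution p \<gamma> a T u \<longleftrightarrow>
     (\<exists>u'. positive_solution p \<gamma> a T u u' \<and> u' 0 = 0 \<and> u' T = 0)"

definition periodic_positive_solution ::
  "real \<Rightarrow> real \<Rightarrow> (real \<Rightarrow> real) \<Rightarrow> real \<Rightarrow> (real \<Rightarrow> real) \<Rightarrow> bool" where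
  "periodic_positive_solution p \<gamma> a T u \<longleftrightarrow>
     (\<exists>u'. positive_solution p \<gamma> a T u u' \<and> u 0 = u T \<and> u' 0 = u' T)"

end

theory Submission
  imports Defs
begin

text \<open>
With the flux \<open>y = phi p u'\<close> and the conjugate exponent \<open>q = p / (p - 1)\<close>, the equation becomes the
planar system \<open>u' = phi q y\<close>, \<open>y' = - a u^\<gamma>\<close>, which is autonomous before and after \<open>\<tau>\<close>. Put
\<open>n = \<gamma> + 1\<close>. While \<open>a\<close> equals a constant \<open>b\<close>, the energy \<open>|y|^q / q + b u^n / n\<close> is conserved, so \<open>u\<close> is a
function of \<open>y\<close>, and since \<open>y\<close> is strictly monotone it can serve as the independent variable:
\<open>dt = - dy / (b u^\<gamma>)\<close>.

Both boundary conditions lead to one normal form. Let \<open>Y = - y(\<tau>)\<close> and \<open>x = u(\<tau>)\<close>. The flux runs from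
\<open>j Y\<close> down to \<open>- Y\<close> on \<open>[0,\<tau>]\<close> and back up to \<open>j Y\<close> on \<open>[\<tau>,T]\<close>, with \<open>j = 0\<close> for the Neumann problem.
For the periodic problem \<open>j = 1\<close>: subtracting the two energy identities gives \<open>u(0) = u(\<tau>)\<close>, hence
\<open>|y(0)| = |y(\<tau>)|\<close>. With \<open>v = y / Y\<close>, \<open>\<eta> = Y^q / (q x^n)\<close>, \<open>\<Lambda> = x^\<gamma> / Y\<close> and \<open>r = \<gamma> / n\<close> the durations
of the two phases read
\<open>A(n \<eta> / a_plus) = a_plus \<Lambda> \<tau>\<close> and \<open>A(- n \<eta> / a_minus) = a_minus \<Lambda> (T - \<tau>)\<close>,
where \<open>A(k)\<close> is the integral of \<open>(1 + k (1 - |v|^q))^(- r)\<close> over \<open>[-1,j]\<close>. This is a proper integral of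
a positive continuous function, unlike the usual time map in the variable \<open>u\<close>.

Everything follows from three properties of \<open>A\<close>. For the exponents in question \<open>r > 0\<close>, so \<open>A\<close> is
strictly decreasing (\<open>dwell_strict_antimono\<close>). The arguments of the two conditions move in opposite
directions as \<open>\<eta>\<close> grows, hence the quotient of the conditions, from which \<open>\<Lambda>\<close> has disappeared,
determines \<open>\<eta>\<close>, and then either condition determines \<open>\<Lambda>\<close>. The pair \<open>(\<eta>, \<Lambda>)\<close> determines \<open>(x, Y)\<close>
because \<open>\<gamma> \<noteq> p - 1\<close> (\<open>parameters_unique\<close>), and \<open>(x, Y)\<close> determines the solution
(\<open>solves_unique\<close>). Comparing with \<open>A(0) = 1 + j\<close> in both conditions shows that
\<open>\<gamma> (a_plus \<tau> - a_minus (T - \<tau>)) < 0\<close> is necessary (\<open>balanced_sign\<close>). Finally \<open>r q \<ge> 1\<close> makes \<open>A(k)\<close>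
unbounded as \<open>k\<close> decreases to \<open>-1\<close> (\<open>dwell_unbounded\<close>), so the intermediate value theorem supplies \<open>\<eta>\<close>
whenever the sign condition holds, and inverting the clock of each phase yields a solution
(\<open>solves_exists\<close>).

Solutions satisfy the equation only almost everywhere, but \<open>u\<close> is continuous, so the right-hand
side is continuous on each phase; the fundamental theorem of calculus for absolutely continuous
functions then shows that the flux is continuously differentiable there.
\<close>

section \<open>The fundamental theorem of calculus for absolutely continuous functions\<close>

lemma absolutely_continuous_fun_on_subset:
  assumes "absolutely_continuous_fun_on f S" and "S' \<subseteq> S"
  shows "absolutely_continuous_fun_on f S'"
  unfolding absolutely_continuous_fun_on_def
proof (intro allI impI)
  fix \<epsilon> :: real assume "\<epsilon> > 0"
  with assms(1) obtain \<delta> where "\<delta> > 0" and d: "\<forall>D :: (real \<times> real) set.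
        finite D \<and>
        (\<forall>(c, d)\<in>D. c < d \<and> {c..d} \<subseteq> S) \<and>
        pairwise (\<lambda>(c, d) (c', d'). {c<..<d} \<inter> {c'<..<d'} = {}) D \<and>
        (\<Sum>(c, d)\<in>D. d - c) < \<delta>
        \<longrightarrow> (\<Sum>(c, d)\<in>D. \<bar>f d - f c\<bar>) < \<epsilon>"
    unfolding absolutely_continuous_fun_on_def by blast
  then show "\<exists>\<delta>>0. \<forall>D :: (real \<times> real) set.
        finite D \<and>
        (\<forall>(c, d)\<in>D. c < d \<and> {c..d} \<subseteq> S') \<and>
        pairwise (\<lambda>(c, d) (c', d'). {c<..<d} \<inter> {c'<..<d'} = {}) D \<and>
        (\<Sum>(c, d)\<in>D. d - c) < \<delta>
        \<longrightarrow> (\<Sum>(c, d)\<in>D. \<bar>f d - f c\<bar>) < \<epsilon>"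
    using assms(2) by (intro exI[of _ \<delta>]) fast
qed

lemma Lipschitz_imp_absolutely_continuous_fun_on:
  assumes L: "\<And>s t. s \<in> S \<Longrightarrow> t \<in> S \<Longrightarrow> \<bar>f t - f s\<bar> \<le> L * \<bar>t - s\<bar>"
  shows "absolutely_continuous_fun_on f S"
  unfolding absolutely_continuous_fun_on_def
proof (intro allI impI)
  fix \<epsilon> :: real assume "\<epsilon> > 0"
  define \<delta> where "\<delta> = \<epsilon> / (\<bar>L\<bar> + 1)"
  have "\<delta> > 0" using \<open>\<epsilon> > 0\<close> by (simp add: \<delta>_def)
  have "(\<Sum>(c, d)\<in>D. \<bar>f d - f c\<bar>) < \<epsilon>"
    if D: "finite D" "\<forall>(c, d)\<in>D. c < d \<and> {c..d} \<subseteq> S" "(\<Sum>(c, d)\<in>D. d - c) < \<delta>" for D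
  proof -
    have "(\<Sum>(c, d)\<in>D. \<bar>f d - f c\<bar>) \<le> (\<Sum>(c, d)\<in>D. (\<bar>L\<bar> + 1) * (d - c))"
    proof (rule sum_mono, clarify)
      fix c d assume "(c, d) \<in> D"
      with D have "c < d" "c \<in> S" "d \<in> S" by (force simp: subset_iff)+
      with L[of c d] have "\<bar>f d - f c\<bar> \<le> L * (d - c)" by simp
      also have "\<dots> \<le> (\<bar>L\<bar> + 1) * (d - c)"
        using \<open>c < d\<close> by (intro mult_right_mono) auto
      finally show "\<bar>f d - f c\<bar> \<le> (\<bar>L\<bar> + 1) * (d - c)" .
    qed
    also have "\<dots> = (\<bar>L\<bar> + 1) * (\<Sum>(c, d)\<in>D. d - c)"
      by (simp add: sum_distrib_left case_prod_unfold)
    also have "\<dots> < (\<bar>L\<bar> + 1) * \<delta>"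
      using D(3) by (intro mult_strict_left_mono) auto
    also have "\<dots> = \<epsilon>" by (simp add: \<delta>_def add_nonneg_eq_0_iff)
    finally show ?thesis .
  qed
  with \<open>\<delta> > 0\<close> show "\<exists>\<delta>>0. \<forall>D :: (real \<times> real) set.
        finite D \<and>
        (\<forall>(c, d)\<in>D. c < d \<and> {c..d} \<subseteq> S) \<and>
        pairwise (\<lambda>(c, d) (c', d'). {c<..<d} \<inter> {c'<..<d'} = {}) D \<and>
        (\<Sum>(c, d)\<in>D. d - c) < \<delta>
        \<longrightarrow> (\<Sum>(c, d)\<in>D. \<bar>f d - f c\<bar>) < \<epsilon>" by blast
qed

text \<open>Open intervals are used here because they are genuinely disjoint when the closed ones only do not
overlap.\<close>

lemma sum_length_disjoint_intervals_le:
  fixes D :: "(real \<times> real) set"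
  assumes "finite D" and less: "\<And>c d. (c, d) \<in> D \<Longrightarrow> c < d"
    and disj: "pairwise (\<lambda>(c, d) (c', d'). {c<..<d} \<inter> {c'<..<d'} = {}) D"
    and U: "U \<in> lmeasurable" and sub: "\<And>c d. (c, d) \<in> D \<Longrightarrow> {c<..<d} \<subseteq> U"
  shows "(\<Sum>(c, d)\<in>D. d - c) \<le> measure lebesgue U"
proof -
  have "(\<Sum>(c, d)\<in>D. d - c) = (\<Sum>z\<in>D. measure lebesgue (case z of (c, d) \<Rightarrow> {c<..<d}))"
    by (rule sum.cong) (use less in \<open>auto simp: less_imp_le\<close>)
  also have "\<dots> = measure lebesgue (\<Union>z\<in>D. case z of (c, d) \<Rightarrow> {c<..<d})"
  proof (rule measure_finite_Union[symmetric])
    show "disjoint_family_on (\<lambda>z. case z of (c, d) \<Rightarrow> {c<..<d}) D"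
      using disj by (fastforce simp: disjoint_family_on_def pairwise_def)
  qed (use \<open>finite D\<close> less in \<open>auto simp: emeasure_lborel_Ioo less_imp_le\<close>)
  also have "\<dots> \<le> measure lebesgue U"
    using sub by (intro measure_mono_fmeasurable U) (auto intro!: sets.finite_UN \<open>finite D\<close>)
  finally show ?thesis .
qed

text \<open>Translates the intervals of a partial division into the endpoint pairs in terms of which absolute
continuity is formulated. Degenerate intervals have to be discarded first: they do not give pairs
with \<open>c < d\<close>, and different tags may carry the same degenerate interval.\<close>

lemma absolutely_continuous_tagged_bound:
  fixes f :: "real \<Rightarrow> real"
  assumes \<delta>: "\<And>D. finite D \<Longrightarrow> (\<And>c d. (c, d) \<in> D \<Longrightarrow> c < d \<and> {c..d} \<subseteq> {a..b}) \<Longrightarrow>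
        pairwise (\<lambda>(c, d) (c', d'). {c<..<d} \<inter> {c'<..<d'} = {}) D \<Longrightarrow>
        (\<Sum>(c, d)\<in>D. d - c) < \<delta> \<Longrightarrow> (\<Sum>(c, d)\<in>D. \<bar>f d - f c\<bar>) < \<epsilon>"
    and p: "p tagged_partial_division_of {a..b}"
    and U: "U \<in> lmeasurable" "measure lebesgue U < \<delta>" and sub: "\<And>x K. (x, K) \<in> p \<Longrightarrow> K \<subseteq> U"
  shows "(\<Sum>(x, K)\<in>p. \<bar>f (Sup K) - f (Inf K)\<bar>) < \<epsilon>"
proof -
  define p' where "p' = {z \<in> p. Inf (snd z) < Sup (snd z)}"
  define e where "e = (\<lambda>z :: real \<times> real set. (Inf (snd z), Sup (snd z)))"
  note pD = tagged_partial_division_ofD[OF p]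
  have K: "K = {Inf K..Sup K} \<and> Inf K \<le> Sup K \<and> K \<subseteq> {a..b} \<and> K \<subseteq> U" if xK: "(x, K) \<in> p" for x K
  proof -
    obtain u v where "K = cbox u v" using pD(4)[OF xK] by blast
    moreover have "x \<in> K" using pD(2)[OF xK] .
    ultimately show ?thesis using pD(3)[OF xK] sub[OF xK] by auto
  qed
  have fin: "finite p'" "finite p" using pD(1) by (auto simp: p'_def)
  have sep: "{Inf K<..<Sup K} \<inter> {Inf K'<..<Sup K'} = {}"
    if "(x, K) \<in> p" "(x', K') \<in> p" "(x, K) \<noteq> (x', K')" for x K x' K'
  proof -
    have "interior K \<inter> interior K' = {}" using pD(5)[OF that] .
    moreover have "interior K = {Inf K<..<Sup K}" "interior K' = {Inf K'<..<Sup K'}"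
      using K[OF that(1)] K[OF that(2)] by (metis interior_atLeastAtMost_real)+
    ultimately show ?thesis by simp
  qed
  have inj: "inj_on e p'"
  proof (rule inj_onI, clarify)
    fix x K x' K'
    assume *: "(x, K) \<in> p'" "(x', K') \<in> p'" "e (x, K) = e (x', K')"
    then have in_p: "(x, K) \<in> p" "(x', K') \<in> p" and less: "Inf K < Sup K" by (auto simp: p'_def)
    have "{Inf K<..<Sup K} \<inter> {Inf K'<..<Sup K'} \<noteq> {}" using * less by (auto simp: e_def)
    then have "(x, K) = (x', K')" using sep[OF in_p] by blast
    then show "x = x' \<and> K = K'" by simp
  qed
  have "(\<Sum>(x, K)\<in>p. \<bar>f (Sup K) - f (Inf K)\<bar>) = (\<Sum>(x, K)\<in>p'. \<bar>f (Sup K) - f (Inf K)\<bar>)"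
  proof (rule sum.mono_neutral_right)
    show "\<forall>z\<in>p - p'. (case z of (x, K) \<Rightarrow> \<bar>f (Sup K) - f (Inf K)\<bar>) = 0"
    proof clarify
      fix x K assume "(x, K) \<in> p" "(x, K) \<notin> p'"
      then have "Inf K = Sup K" using K[of x K] by (auto simp: p'_def)
      then show "\<bar>f (Sup K) - f (Inf K)\<bar> = 0" by simp
    qed
  qed (use fin in \<open>auto simp: p'_def\<close>)
  also have "\<dots> = (\<Sum>(c, d)\<in>e ` p'. \<bar>f d - f c\<bar>)"
    unfolding sum.reindex[OF inj] by (simp add: e_def case_prod_unfold)
  also have "\<dots> < \<epsilon>"
  proof (rule \<delta>)
    show cd: "c < d \<and> {c..d} \<subseteq> {a..b}" if "(c, d) \<in> e ` p'" for c d
      using that K by (fastforce simp: e_def p'_def)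
    have cdU: "{c<..<d} \<subseteq> U" if "(c, d) \<in> e ` p'" for c d
    proof -
      from that obtain x K where "(x, K) \<in> p" "c = Inf K" "d = Sup K" by (auto simp: e_def p'_def)
      with K[of x K] show ?thesis
        by (metis greaterThanLessThan_subseteq_atLeastAtMost_iff order_refl order_trans)
    qed
    show pw: "pairwise (\<lambda>(c, d) (c', d'). {c<..<d} \<inter> {c'<..<d'} = {}) (e ` p')"
      using sep by (auto simp: pairwise_image pairwise_def e_def p'_def)
    show "(\<Sum>(c, d)\<in>e ` p'. d - c) < \<delta>"
      using sum_length_disjoint_intervals_le[OF _ _ pw U(1) cdU] cd fin U(2) by force
  qed (use fin in auto)
  finally show ?thesis .
qed

lemma negligible_outer_open:
  assumes "negligible (N :: real set)" "\<delta> > 0"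
  obtains U where "open U" "N \<subseteq> U" "U \<in> lmeasurable" "measure lebesgue U < \<delta>"
proof -
  have N: "N \<in> lmeasurable" using assms(1) by (rule negligible_imp_measurable)
  obtain U where U: "open U" "N \<subseteq> U" "U - N \<in> lmeasurable" "emeasure lebesgue (U - N) < ennreal \<delta>"
    using sets_lebesgue_outer_open[OF fmeasurableD[OF N] assms(2)] by metis
  have "U \<in> lmeasurable"
    using fmeasurable.Un[OF U(3) N] U(2) by (simp add: Un_absorb2 Un_Diff_cancel2)
  moreover have "measure lebesgue U = measure lebesgue (U - N)"
    using assms(1) U(1) by (metis \<open>U \<in> lmeasurable\<close> fmeasurableD measure_Diff_null_set negligible_iff_null_sets)
  moreover have "measure lebesgue (U - N) < \<delta>"
    using U(3,4) assms(2) by (simp add: emeasure_eq_measure2 ennreal_less_iff)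
  ultimately show thesis using that U by simp
qed

text \<open>The gauge integral allows a direct proof, without Vitali coverings. At points outside \<open>N\<close> the gauge
comes from the derivative, so the increments of \<open>f\<close> over the intervals tagged there agree with the
Riemann sum. At points of \<open>N\<close> the gauge keeps the interval inside an open set \<open>U\<close> of small measure
that covers \<open>N\<close>, so absolute continuity makes the sum of these increments small.\<close>

theorem absolutely_continuous_fundamental_theorem:
  fixes f g :: "real \<Rightarrow> real"
  assumes ac: "absolutely_continuous_fun_on f {a..b}" and "a \<le> b"
    and N: "negligible N"
    and deriv: "\<And>x. x \<in> {a..b} - N \<Longrightarrow> (f has_real_derivative g x) (at x within {a..b})"
  shows "(g has_integral (f b - f a)) {a..b}"
proof -
  \<comment> \<open>Changing \<open>g\<close> on a null set does not affect the integral, and removes its uncontrolled values from the Riemann sums.\<close>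
  define h where "h = (\<lambda>x. if x \<in> N then 0 else g x)"
  have "(h has_integral (f b - f a)) {a..b}"
    unfolding has_integral_real
  proof (intro allI impI)
    fix \<epsilon> :: real assume "\<epsilon> > 0"
    \<comment> \<open>The summand 1 covers the case \<open>a = b\<close>.\<close>
    define \<eta> where "\<eta> = \<epsilon> / 2 / (b - a + 1)"
    have "\<eta> > 0" "\<eta> * (b - a) < \<epsilon> / 2"
      using \<open>\<epsilon> > 0\<close> \<open>a \<le> b\<close> by (auto simp: \<eta>_def field_simps)
    from \<open>\<epsilon> > 0\<close> have "\<epsilon> / 2 > 0" by simp
    with ac obtain \<delta> where "\<delta> > 0" and \<delta>: "\<forall>D :: (real \<times> real) set.
        finite D \<and>
        (\<forall>(c, d)\<in>D. c < d \<and> {c..d} \<subseteq> {a..b}) \<and>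
        pairwise (\<lambda>(c, d) (c', d'). {c<..<d} \<inter> {c'<..<d'} = {}) D \<and>
        (\<Sum>(c, d)\<in>D. d - c) < \<delta>
        \<longrightarrow> (\<Sum>(c, d)\<in>D. \<bar>f d - f c\<bar>) < \<epsilon> / 2"
      unfolding absolutely_continuous_fun_on_def by blast
    obtain U where U: "open U" "N \<subseteq> U" "U \<in> lmeasurable" "measure lebesgue U < \<delta>"
      using negligible_outer_open[OF N \<open>\<delta> > 0\<close>] .
    have "\<exists>d>0. (x \<in> N \<longrightarrow> ball x d \<subseteq> U) \<and>
        (x \<in> {a..b} - N \<longrightarrow> (\<forall>y\<in>{a..b}. \<bar>y - x\<bar> < d \<longrightarrow> \<bar>f y - f x - (y - x) * g x\<bar> \<le> \<eta> * \<bar>y - x\<bar>))" for x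
    proof (cases "x \<in> N")
      case True
      then show ?thesis using U(1,2) by (metis Diff_iff openE subsetD)
    next
      case False
      show ?thesis
      proof (cases "x \<in> {a..b}")
        case True
        with False have "(f has_derivative (*) (g x)) (at x within {a..b})"
          using deriv by (simp add: has_field_derivative_def)
        then obtain d where "d > 0" "\<forall>y\<in>{a..b}. norm (y - x) < d \<longrightarrow> norm (f y - f x - g x * (y - x)) \<le> \<eta> * norm (y - x)"
          unfolding has_derivative_within_alt using \<open>\<eta> > 0\<close> by blast
        with False show ?thesis by (intro exI[of _ d]) (simp add: mult.commute)
      qed (use False in \<open>auto intro: exI[of _ 1]\<close>)
    qed
    then obtain d where d: "\<And>x. d x > 0" "\<And>x. x \<in> N \<Longrightarrow> ball x (d x) \<subseteq> U"
        "\<And>x y. x \<in> {a..b} - N \<Longrightarrow> y \<in> {a..b} \<Longrightarrow> \<bar>y - x\<bar> < d x \<Longrightarrow> \<bar>f y - f x - (y - x) * g x\<bar> \<le> \<eta> * \<bar>y - x\<bar>"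
      by metis
    have "norm ((\<Sum>(x, K)\<in>p. measure lborel K *\<^sub>R h x) - (f b - f a)) < \<epsilon>"
      if p: "p tagged_division_of {a..b}" and fine: "(\<lambda>x. ball x (d x)) fine p" for p
    proof -
      have finp: "finite p" using tagged_division_ofD(1)[OF p] .
      define err where "err = (\<lambda>z :: real \<times> real set. measure lborel (snd z) * h (fst z) - (f (Sup (snd z)) - f (Inf (snd z))))"
      define pN where "pN = {z \<in> p. fst z \<in> N}"
      have K: "\<exists>u v. K = {u..v} \<and> u \<le> x \<and> x \<le> v \<and> {u..v} \<subseteq> {a..b} \<and> {u..v} \<subseteq> ball x (d x)"
        if xK: "(x, K) \<in> p" for x K
      proof -
        obtain u v where "K = cbox u v" using tagged_division_ofD(4)[OF p xK] by blast
        moreover have "x \<in> K" "K \<subseteq> {a..b}" using tagged_division_ofD(2,3)[OF p xK] .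
        moreover have "K \<subseteq> ball x (d x)" using fine xK by (auto simp: fine_def)
        ultimately show ?thesis by (intro exI[of _ u] exI[of _ v]) auto
      qed
      have "(\<Sum>(x, K)\<in>p. measure lborel K *\<^sub>R h x) - (f b - f a) = sum err p"
        using additive_tagged_division_1[OF \<open>a \<le> b\<close> p, of f]
        by (simp add: err_def sum_subtractf case_prod_unfold)
      also have "\<dots> = sum err (p - pN) + sum err pN"
        using finp by (intro sum.subset_diff) (auto simp: pN_def)
      finally have split: "(\<Sum>(x, K)\<in>p. measure lborel K *\<^sub>R h x) - (f b - f a) = sum err (p - pN) + sum err pN" .
      have "\<bar>err z\<bar> \<le> \<eta> * (Sup (snd z) - Inf (snd z))" if z: "z \<in> p - pN" for z
      proof -
        obtain x L where zx: "z = (x, L)" "x \<notin> N" "(x, L) \<in> p" using z by (cases z) (auto simp: pN_def)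
        obtain u v where uv: "L = {u..v}" "u \<le> x" "x \<le> v" "{u..v} \<subseteq> {a..b}" "{u..v} \<subseteq> ball x (d x)"
          using K[OF zx(3)] by blast
        have "u \<in> {u..v}" "v \<in> {u..v}" "x \<in> {u..v}" using uv by auto
        then have "u \<in> ball x (d x)" "v \<in> ball x (d x)" "u \<in> {a..b}" "v \<in> {a..b}" "x \<in> {a..b}"
          using uv(4,5) by blast+
        then have mem: "x \<in> {a..b} - N" "u \<in> {a..b}" "v \<in> {a..b}" "\<bar>u - x\<bar> < d x" "\<bar>v - x\<bar> < d x"
          using zx(2) by (simp_all add: dist_real_def abs_minus_commute)
        have "\<bar>f u - f x - (u - x) * g x\<bar> \<le> \<eta> * (x - u)" "\<bar>f v - f x - (v - x) * g x\<bar> \<le> \<eta> * (v - x)"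
          using d(3)[OF mem(1,2,4)] d(3)[OF mem(1,3,5)] uv by auto
        moreover have "err z = (f u - f x - (u - x) * g x) - (f v - f x - (v - x) * g x)"
          using uv zx by (simp add: err_def h_def algebra_simps)
        ultimately have "\<bar>err z\<bar> \<le> \<eta> * (x - u) + \<eta> * (v - x)" by linarith
        then show ?thesis using uv zx by (simp add: algebra_simps)
      qed
      then have "\<bar>sum err (p - pN)\<bar> \<le> (\<Sum>z\<in>p - pN. \<eta> * (Sup (snd z) - Inf (snd z)))"
        unfolding real_norm_def[symmetric] by (rule sum_norm_le)
      also have "\<dots> \<le> (\<Sum>z\<in>p. \<eta> * (Sup (snd z) - Inf (snd z)))"
      proof (rule sum_mono2)
        show "0 \<le> \<eta> * (Sup (snd z) - Inf (snd z))" if "z \<in> p - (p - pN)" for z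
          using that K[of "fst z" "snd z"] \<open>\<eta> > 0\<close> by fastforce
      qed (use finp in auto)
      also have "\<dots> = \<eta> * (b - a)"
        using additive_tagged_division_1[OF \<open>a \<le> b\<close> p, of "\<lambda>x. x"]
        by (simp add: case_prod_unfold flip: sum_distrib_left)
      finally have good: "\<bar>sum err (p - pN)\<bar> < \<epsilon> / 2" using \<open>\<eta> * (b - a) < \<epsilon> / 2\<close> by linarith
      have "\<bar>sum err pN\<bar> \<le> (\<Sum>z\<in>pN. \<bar>f (Sup (snd z)) - f (Inf (snd z))\<bar>)"
        unfolding real_norm_def[symmetric] by (rule sum_norm_le) (auto simp: err_def h_def pN_def)
      also have "\<dots> = (\<Sum>(x, L)\<in>pN. \<bar>f (Sup L) - f (Inf L)\<bar>)" by (simp add: case_prod_unfold)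
      also have "\<dots> < \<epsilon> / 2"
      proof (rule absolutely_continuous_tagged_bound[OF _ _ U(3,4)])
        show "pN tagged_partial_division_of {a..b}"
          using p tagged_partial_division_subset by (fastforce simp: pN_def tagged_division_of_def)
        show "L \<subseteq> U" if "(x, L) \<in> pN" for x L
          using that K[of x L] d(2)[of x] by (fastforce simp: pN_def)
      qed (use \<delta> in blast)
      finally have "\<bar>sum err pN\<bar> < \<epsilon> / 2" .
      with good split show ?thesis by simp
    qed
    moreover have "gauge (\<lambda>x. ball x (d x))" using d(1) by (rule gauge_ball_dependent[rule_format])
    ultimately show "\<exists>\<gamma>. gauge \<gamma> \<and> (\<forall>p. p tagged_division_of {a..b} \<and> \<gamma> fine p \<longrightarrow>
        norm ((\<Sum>(x, K)\<in>p. measure lborel K *\<^sub>R h x) - (f b - f a)) < \<epsilon>)" by blast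
  qed
  then show ?thesis by (rule has_integral_spike[OF N, rotated]) (simp add: h_def)
qed

corollary absolutely_continuous_has_real_derivative:
  fixes f g :: "real \<Rightarrow> real"
  assumes ac: "absolutely_continuous_fun_on f {a..b}" and g: "continuous_on {a..b} g"
    and N: "negligible N"
    and deriv: "\<And>x. x \<in> {a..b} - N \<Longrightarrow> (f has_real_derivative g x) (at x within {a..b})"
    and t: "t \<in> {a..b}"
  shows "(f has_real_derivative g t) (at t within {a..b})"
proof (rule has_field_derivative_transform_within[OF _ zero_less_one t])
  show "((\<lambda>t. f a + integral {a..t} g) has_real_derivative g t) (at t within {a..b})"
    using integral_has_real_derivative[OF g t] by (auto intro!: derivative_eq_intros)
  show "f a + integral {a..s} g = f s" if s: "s \<in> {a..b}" for s
  proof -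
    have "(g has_integral (f s - f a)) {a..s}"
    proof (rule absolutely_continuous_fundamental_theorem[OF _ _ N])
      show "absolutely_continuous_fun_on f {a..s}"
        using ac s by (rule_tac absolutely_continuous_fun_on_subset) auto
      show "(f has_real_derivative g x) (at x within {a..s})" if "x \<in> {a..s} - N" for x
        using that s by (intro DERIV_subset[OF deriv]) auto
    qed (use s in auto)
    then show ?thesis by (simp add: integral_unique)
  qed
qed

section \<open>The odd power function\<close>

lemma has_real_derivative_abs_powr:
  assumes "q > 1"
  shows "((\<lambda>v::real. \<bar>v\<bar> powr q) has_real_derivative q * phi q v) (at v)"
proof -
  consider "v > 0" | "v < 0" | "v = 0" by linarith
  then show ?thesis
  proof cases
    case 1
    have "((\<lambda>v. v powr q) has_real_derivative q * phi q v) (at v)"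
      using 1 has_real_derivative_powr[of v q] powr_mult_base[of v "q - 2"] by (simp add: phi_def mult.commute)
    then show ?thesis
      by (rule has_field_derivative_transform_within_open[where S = "{0<..}"]) (use 1 in auto)
  next
    case 2
    have "((\<lambda>v. (- v) powr q) has_real_derivative q * (- v) powr (q - 1) * - 1) (at v)"
      using 2 by (auto intro!: derivative_eq_intros simp: powr_diff field_simps)
    moreover have "(- v) powr (q - 1) = - (v * (- v) powr (q - 2))"
      using 2 powr_mult_base[of "- v" "q - 2"] by simp
    then have "q * (- v) powr (q - 1) * - 1 = q * phi q v"
      using 2 by (simp add: phi_def)
    ultimately have "((\<lambda>v. (- v) powr q) has_real_derivative q * phi q v) (at v)" by simp
    then show ?thesis
      by (rule has_field_derivative_transform_within_open[where S = "{..<0}"]) (use 2 in auto)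
  next
    case 3
    have "((\<lambda>h. \<bar>h\<bar> powr (q - 1)) \<longlongrightarrow> 0) (at (0::real))"
      by (rule tendsto_eq_intros | use assms in \<open>auto intro!: tendsto_eq_intros\<close>)+
    moreover have "\<bar>\<bar>h\<bar> powr q / h\<bar> = \<bar>h\<bar> powr (q - 1)" for h :: real
      by (cases "h = 0") (auto simp: powr_diff)
    ultimately have "((\<lambda>h. \<bar>h\<bar> powr q / h) \<longlongrightarrow> 0) (at (0::real))"
      by (subst tendsto_rabs_zero_iff[symmetric]) simp
    then show ?thesis using 3 assms by (simp add: DERIV_def phi_def)
  qed
qed

text \<open>For conjugate exponents the odd powers \<open>phi p\<close> and \<open>phi q\<close> are inverse to each other.\<close>

lemma phi_phi:
  assumes "(p - 1) * (q - 1) = 1"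
  shows "phi p (phi q s) = s"
proof (cases "s = 0")
  case False
  have "\<bar>phi q s\<bar> = \<bar>s\<bar> powr (q - 1)"
    using False powr_mult_base[of "\<bar>s\<bar>" "q - 2"] by (simp add: phi_def abs_mult mult.commute)
  then have "phi p (phi q s) = \<bar>s\<bar> powr ((q - 1) * (p - 2)) * (\<bar>s\<bar> powr (q - 2) * s)"
    by (simp add: phi_def powr_powr)
  also have "\<dots> = \<bar>s\<bar> powr ((q - 1) * (p - 2) + (q - 2)) * s"
    by (simp add: powr_add)
  also have "(q - 1) * (p - 2) + (q - 2) = 0" using assms by (simp add: algebra_simps)
  finally show ?thesis using False by simp
qed (simp add: phi_def)

lemma phi_mult: "Y \<ge> 0 \<Longrightarrow> phi q (Y * v) = Y powr (q - 1) * phi q v"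
  using powr_mult_base[of Y "q - 2"] by (simp add: phi_def abs_mult powr_mult mult_ac)

text \<open>The defining formula involves a negative power when \<open>q < 2\<close>; as a difference of powers of positive
and negative part with exponent \<open>q - 1 > 0\<close> the function is visibly continuous at 0.\<close>

lemma continuous_on_phi:
  assumes "q > 1"
  shows "continuous_on S (phi q)"
proof -
  have "phi q v = (max v 0) powr (q - 1) - (max (- v) 0) powr (q - 1)" for v
    using assms powr_mult_base[of "\<bar>v\<bar>" "q - 2"]
    by (cases "v > 0"; cases "v = 0") (auto simp: phi_def mult.commute max_def)
  moreover have "continuous_on S (\<lambda>v::real. (max v 0) powr (q - 1) - (max (- v) 0) powr (q - 1))"
    using assms by (intro continuous_intros continuous_on_powr') auto
  ultimately show ?thesis by (metis (no_types, lifting) continuous_on_cong)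
qed

section \<open>Time as a function of the rescaled flux\<close>

text \<open>By conservation of energy, \<open>(u / x)^n = profile q k v\<close> along a phase, as a function of the rescaled
flux \<open>v = y / Y\<close>. Phases only visit \<open>|v| \<le> 1\<close>; the truncation by \<open>min\<close> extends the
function, for \<open>k > -1\<close>, to a positive one on the whole line, so that the endpoints \<open>v = -1\<close> and \<open>v = 1\<close> are interior
points for the clock below.\<close>

definition profile :: "real \<Rightarrow> real \<Rightarrow> real \<Rightarrow> real" where
  "profile q k v = 1 + k * (1 - (min 1 \<bar>v\<bar>) powr q)"

text \<open>Time in units of \<open>Y / (b x^\<gamma>)\<close>, up to sign and an additive constant, at which the rescaled flux has the value \<open>z\<close>. The lower
limit \<open>-2\<close> is an arbitrary point to the left of \<open>-1\<close>.\<close>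

definition clock :: "real \<Rightarrow> real \<Rightarrow> real \<Rightarrow> real \<Rightarrow> real" where
  "clock q r k z = integral {-2..z} (\<lambda>v. profile q k v powr - r)"

text \<open>The rescaled duration of a phase in which \<open>v\<close> moves between \<open>-1\<close> and \<open>j\<close>; the function called \<open>A(k)\<close>
above.\<close>

definition dwell :: "real \<Rightarrow> real \<Rightarrow> real \<Rightarrow> real \<Rightarrow> real" where
  "dwell q r j k = clock q r k j - clock q r k (-1)"

lemma profile_eq: "\<bar>v\<bar> \<le> 1 \<Longrightarrow> profile q k v = 1 + k * (1 - \<bar>v\<bar> powr q)"
  by (simp add: profile_def min_def)

lemma profile_pos:
  assumes "k > -1" "q > 1"
  shows "profile q k v > 0"
proof -
  define m where "m = (min 1 \<bar>v\<bar>) powr q"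
  have "0 \<le> m" "m \<le> 1" using assms by (auto simp: m_def intro!: powr_le1)
  show ?thesis
  proof (cases "m = 1")
    case False
    then have "(- 1) * (1 - m) < k * (1 - m)" using assms \<open>m \<le> 1\<close> by (intro mult_strict_right_mono) auto
    then show ?thesis using \<open>0 \<le> m\<close> unfolding profile_def m_def[symmetric] by (simp add: algebra_simps)
  qed (simp add: profile_def flip: m_def)
qed

lemma continuous_on_profile_powr:
  assumes "q > 1" "k > -1"
  shows "continuous_on S (\<lambda>v. profile q k v powr s)"
proof -
  have "continuous_on S (\<lambda>v. profile q k v)" unfolding profile_def
    using assms by (intro continuous_intros continuous_on_powr') auto
  then show ?thesis
    using profile_pos[OF assms(2,1)] by (intro continuous_intros) (auto simp: less_imp_neq[symmetric])
qed

lemma clock_has_real_derivative: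
  assumes "q > 1" "k > -1" "-2 < z" "z < 2"
  shows "(clock q r k has_real_derivative profile q k z powr - r) (at z)"
proof -
  have "(clock q r k has_real_derivative profile q k z powr - r) (at z within {-2..2})"
    unfolding clock_def
    using assms by (intro integral_has_real_derivative continuous_on_profile_powr) auto
  moreover have "at z within {-2..2} = at z"
    using assms by (intro at_within_interior) auto
  ultimately show ?thesis by simp
qed

lemma clock_strict_mono:
  assumes "q > 1" "k > -1" "-2 < y" "y < z" "z < 2"
  shows "clock q r k y < clock q r k z"
proof (rule DERIV_pos_imp_increasing[OF \<open>y < z\<close>])
  fix x assume "y \<le> x" "x \<le> z"
  then show "\<exists>d. (clock q r k has_real_derivative d) (at x) \<and> d > 0"
    using assms clock_has_real_derivative[of q k x r] profile_pos[of k q x]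
    by (intro exI[of _ "profile q k x powr - r"]) auto
qed

text \<open>The inverse of the clock solves the autonomous equation \<open>v' = profile q k v powr r\<close>; this replaces an
existence theorem for differential equations.\<close>

lemma clock_inverse:
  assumes q: "q > 1" and k: "k > -1"
  obtains N where "\<And>z. z \<in> {-1..1} \<Longrightarrow> N (clock q r k z) = z"
    and "\<And>s. s \<in> {clock q r k (-1)..clock q r k 1} \<Longrightarrow> N s \<in> {-1..1} \<and> clock q r k (N s) = s \<and>
           (N has_real_derivative profile q k (N s) powr r) (at s)"
proof -
  \<comment> \<open>Any \<open>c\<close> strictly between 1 and 2 makes \<open>[-1,1]\<close> interior to \<open>[-c,c]\<close>, and \<open>[-c,c]\<close> interior to \<open>[-2,2]\<close>.\<close>
  define c where "c = (3/2 :: real)"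
  define M where "M = clock q r k"
  define N where "N = inv_into {-c..c} M"
  have D: "(M has_real_derivative profile q k z powr - r) (at z)" if "-2 < z" "z < 2" for z
    unfolding M_def using clock_has_real_derivative[OF q k that] .
  have cont: "isCont M z" if "-2 < z" "z < 2" for z using DERIV_isCont[OF D[OF that]] .
  have mono: "M y < M z" if "-2 < y" "y < z" "z < 2" for y z
    unfolding M_def using clock_strict_mono[OF q k that] .
  have "inj_on M {-c..c}"
  proof (rule linorder_inj_onI)
    show "M y \<noteq> M z" if "y < z" "y \<in> {-c..c}" "z \<in> {-c..c}" for y z
      using mono[of y z] that by (auto simp: c_def)
  qed auto
  then have NM: "N (M z) = z" if "z \<in> {-c..c}" for z
    unfolding N_def using that by (rule inv_into_f_f)
  have ivt: "\<exists>z\<ge>y. z \<le> y' \<and> M z = s" if "-c \<le> y" "y \<le> y'" "y' \<le> c" "M y \<le> s" "s \<le> M y'" for s y y'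
    using that by (intro IVT) (auto intro!: cont simp: c_def)
  show thesis
  proof (rule that[of N])
    show "N (clock q r k z) = z" if "z \<in> {-1..1}" for z
      using that by (intro NM[unfolded M_def]) (auto simp: c_def)
    fix s assume s: "s \<in> {clock q r k (-1)..clock q r k 1}"
    obtain z where z: "-1 \<le> z" "z \<le> 1" "M z = s"
      using ivt[of "-1" 1 s] s by (auto simp: c_def M_def)
    have Ns: "N s = z" using NM[of z] z by (auto simp: c_def)
    have "isCont N (M z)"
      by (rule isCont_inverse_function2[of "-c" _ c]) (use z NM cont in \<open>auto simp: c_def\<close>)
    moreover have "M (-c) < s" "s < M c"
      using mono[of "-c" z] mono[of z c] z by (auto simp: c_def)
    moreover have "M (N s') = s'" if "M (-c) < s'" "s' < M c" for s'
      using ivt[of "-c" c s'] that NM by (force simp: c_def)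
    ultimately have "(N has_real_derivative inverse (profile q k z powr - r)) (at s)"
      using z Ns D[of z] profile_pos[OF k q, of z]
      by (intro DERIV_inverse_function[where f = M and a = "M (-c)" and b = "M c"]) auto
    then show "N s \<in> {-1..1} \<and> clock q r k (N s) = s \<and>
           (N has_real_derivative profile q k (N s) powr r) (at s)"
      using z Ns by (simp add: powr_minus M_def)
  qed
qed

text \<open>A larger \<open>k\<close> raises the profile wherever \<open>|v| < 1\<close>, and the exponent \<open>- r\<close> is negative.\<close>

lemma dwell_strict_antimono:
  assumes "q > 1" "r > 0" "-1 < j" "j \<le> 1" "-1 < k" "k < k'"
  shows "dwell q r j k' < dwell q r j k"
proof -
  define h where "h = (\<lambda>z. clock q r k z - clock q r k' z)"
  have D: "(h has_real_derivative profile q k z powr - r - profile q k' z powr - r) (at z)"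
    if "-2 < z" "z < 2" for z
    unfolding h_def using assms that by (intro DERIV_diff clock_has_real_derivative) auto
  have "h (-1) < h j"
  proof (rule DERIV_pos_imp_increasing_open[OF \<open>-1 < j\<close>])
    fix z assume z: "-1 < z" "z < j"
    then have "\<bar>z\<bar> < 1" using assms by auto
    then have "\<bar>z\<bar> powr q < 1" using assms powr_less_mono2[of q "\<bar>z\<bar>" 1] by simp
    then have "profile q k z < profile q k' z"
      using \<open>\<bar>z\<bar> < 1\<close> assms by (simp add: profile_eq)
    then have "profile q k' z powr - r < profile q k z powr - r"
      using assms by (intro powr_less_mono2_neg profile_pos) auto
    then show "\<exists>d. (h has_real_derivative d) (at z) \<and> d > 0"
      using D[of z] z assms by (intro exI[of _ "profile q k z powr - r - profile q k' z powr - r"]) simp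
  next
    show "continuous_on {-1..j} h"
      using assms by (intro continuous_at_imp_continuous_on ballI DERIV_isCont[OF D]) auto
  qed
  then show ?thesis by (simp add: h_def dwell_def)
qed

lemma dwell_zero: "-1 \<le> j \<Longrightarrow> dwell q r j 0 = 1 + j"
  by (simp add: dwell_def clock_def profile_def)

lemma dwell_pos:
  assumes "q > 1" "k > -1" "-1 < j" "j \<le> 1"
  shows "dwell q r j k > 0"
  using clock_strict_mono[of q k "-1" j] assms by (simp add: dwell_def)

lemma continuous_on_dwell:
  assumes "q > 1"
  shows "continuous_on {-1<..} (dwell q r j)"
proof -
  have "continuous_on {-1<..} (\<lambda>k. integral (cbox (-2) z) (\<lambda>v. profile q k v powr - r))" for z
  proof (rule integral_continuous_on_param)
    have "continuous_on ({-1<..} \<times> cbox (-2) z) (\<lambda>x. profile q (fst x) (snd x))"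
      unfolding profile_def using assms by (intro continuous_intros continuous_on_powr') auto
    then show "continuous_on ({-1<..} \<times> cbox (-2) z) (\<lambda>(k, v). profile q k v powr - r)"
      unfolding case_prod_unfold using assms
      by (intro continuous_intros) (auto simp: less_imp_neq[OF profile_pos, symmetric])
  qed
  then show ?thesis unfolding dwell_def clock_def by (intro continuous_intros) auto
qed

text \<open>For \<open>k = -1\<close> the profile is \<open>|v|^q\<close>, whose power \<open>- r\<close> is not integrable at 0 because \<open>r q \<ge> 1\<close>. For
\<open>k = \<epsilon>^q - 1\<close> this is made quantitative: when \<open>\<epsilon> \<le> |v| \<le> 1\<close> the profile is at most \<open>2 |v|^q\<close>, so the
integrand is at least \<open>2^(- r) / |v|\<close>, and \<open>[-1, - \<epsilon>]\<close> alone contributes at least \<open>- 2^(- r) ln \<epsilon>\<close>.\<close>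

lemma dwell_unbounded:
  assumes q: "q > 1" and r: "r > 0" "r * q \<ge> 1" and j: "0 \<le> j" "j \<le> 1" and "C > 0"
  obtains k where "-1 < k" "k < 0" "dwell q r j k > C"
proof -
  define \<epsilon> where "\<epsilon> = exp (- (C + 1) * 2 powr r)"
  have "- (2 powr - r) * ln \<epsilon> = (C + 1) * (2 powr - r * 2 powr r)"
    by (simp add: \<epsilon>_def algebra_simps)
  also have "2 powr - r * 2 powr r = 1" by (simp add: powr_minus)
  finally have \<epsilon>: "0 < \<epsilon>" "\<epsilon> < 1" "- (2 powr - r) * ln \<epsilon> > C"
    using \<open>C > 0\<close> by (auto simp: \<epsilon>_def mult_neg_pos)
  define k where "k = \<epsilon> powr q - 1"
  have k: "-1 < k" "k < 0" using \<epsilon> q powr_less_mono2[of q \<epsilon> 1] by (auto simp: k_def)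
  define h where "h = (\<lambda>z. clock q r k z + 2 powr - r * ln (- z))"
  have "h (-1) \<le> h (- \<epsilon>)"
  proof (rule DERIV_nonneg_imp_nondecreasing[where f = h])
    fix z assume z: "-1 \<le> z" "z \<le> - \<epsilon>"
    have z': "0 < - z" "\<bar>z\<bar> = - z" "\<bar>z\<bar> \<le> 1" using z \<epsilon> by auto
    \<comment> \<open>The lower bound for the integrand says that \<open>h\<close>, which compares the clock with the logarithm, is nondecreasing.\<close>
    have "profile q k z = \<epsilon> powr q + (1 - \<epsilon> powr q) * (- z) powr q"
      using z' by (simp add: profile_eq k_def algebra_simps)
    also have "\<dots> \<le> (- z) powr q + 1 * (- z) powr q"
      using z z' \<epsilon> q by (intro add_mono powr_mono2 mult_right_mono) auto
    finally have "(2 * (- z) powr q) powr - r \<le> profile q k z powr - r"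
      using profile_pos[OF k(1) q, of z] r by (intro powr_mono2') auto
    moreover have "(- z) powr - 1 \<le> (- z) powr - (r * q)"
      using z z' r by (intro powr_mono') auto
    then have "2 powr - r * (1 / - z) \<le> (2 * (- z) powr q) powr - r"
      using z' mult_left_mono[of "(- z) powr - 1" "(- z) powr - (r * q)" "2 powr - r"]
      by (simp add: powr_mult powr_powr powr_minus mult.commute divide_inverse)
    ultimately have "0 \<le> profile q k z powr - r + 2 powr - r * (1 / z)" by simp
    moreover have "(h has_real_derivative profile q k z powr - r + 2 powr - r * (1 / z)) (at z)"
      unfolding h_def using z z' \<epsilon> q k
      by (auto intro!: derivative_eq_intros clock_has_real_derivative)
    ultimately show "\<exists>d. (h has_real_derivative d) (at z) \<and> 0 \<le> d" by blast
  qed (use \<epsilon> in auto)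
  then have "C < clock q r k (- \<epsilon>) - clock q r k (-1)" using \<epsilon> by (simp add: h_def)
  also have "\<dots> < dwell q r j k"
    using clock_strict_mono[of q k "- \<epsilon>" j r] \<epsilon> q k j by (simp add: dwell_def)
  finally show thesis using that k by blast
qed

text \<open>At \<open>\<kappa> = 0\<close> both dwell times equal \<open>1 + j\<close> and the right-hand side is larger. As \<open>\<kappa>\<close> approaches \<open>b2\<close> the
left-hand side is unbounded while the right-hand side stays below \<open>c1 (1 + j)\<close>.\<close>

lemma dwell_balance:
  assumes q: "q > 1" and r: "r > 0" "r * q \<ge> 1" and j: "0 \<le> j" "j \<le> 1"
    and c: "0 < c2" "c2 < c1" and b: "b1 > 0" "b2 > 0"
  obtains \<kappa> where "0 < \<kappa>" "\<kappa> < b2" "c2 * dwell q r j (- \<kappa> / b2) = c1 * dwell q r j (\<kappa> / b1)"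
proof -
  define C where "C = c1 * (1 + j) / c2"
  have "C > 0" using c j by (simp add: C_def)
  then obtain k0 where k0: "-1 < k0" "k0 < 0" "dwell q r j k0 > C"
    using dwell_unbounded[OF q r j] by metis
  define h where "h = (\<lambda>\<kappa>. c2 * dwell q r j (- \<kappa> / b2) - c1 * dwell q r j (\<kappa> / b1))"
  define \<kappa>0 where "\<kappa>0 = - b2 * k0"
  have \<kappa>0: "0 < \<kappa>0" "\<kappa>0 < b2" using k0 b mult_strict_left_mono[of "- k0" 1 b2] by (auto simp: \<kappa>0_def mult_pos_neg)
  have h0: "h 0 < 0" using c j mult_strict_right_mono[of c2 c1 "1 + j"] by (simp add: h_def dwell_zero)
  have "dwell q r j (\<kappa>0 / b1) < dwell q r j 0"
    using \<kappa>0 b q r j by (intro dwell_strict_antimono) auto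
  then have "c1 * dwell q r j (\<kappa>0 / b1) < c1 * (1 + j)" using c j by (simp add: dwell_zero)
  moreover have "c1 * (1 + j) < c2 * dwell q r j k0"
    using k0(3) c by (simp add: C_def field_simps)
  moreover have "- \<kappa>0 / b2 = k0" using b by (simp add: \<kappa>0_def)
  ultimately have h1: "h \<kappa>0 > 0" by (simp add: h_def)
  have "continuous_on {0..\<kappa>0} h"
    unfolding h_def using b \<kappa>0 k0
    by (intro continuous_intros continuous_on_compose2[OF continuous_on_dwell[OF q]])
       (auto simp: field_simps)
  then obtain \<kappa> where \<kappa>: "0 \<le> \<kappa>" "\<kappa> \<le> \<kappa>0" "h \<kappa> = 0"
    using IVT'[of h 0 0 \<kappa>0] h0 h1 \<kappa>0 by auto
  then have "\<kappa> \<noteq> 0" using h0 by auto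
  then show thesis using that[of \<kappa>] \<kappa> \<kappa>0 by (simp add: h_def)
qed

section \<open>Motion under a constant weight\<close>

text \<open>The equation with constant weight \<open>b\<close>, written for the flux \<open>y\<close> instead of \<open>u'\<close>: both unknowns are then
continuously differentiable even where \<open>u'\<close> vanishes.\<close>

definition phase :: "real \<Rightarrow> real \<Rightarrow> real \<Rightarrow> real \<Rightarrow> real \<Rightarrow> (real \<Rightarrow> real) \<Rightarrow> (real \<Rightarrow> real) \<Rightarrow> bool" where
  "phase q \<gamma> b s e u y \<longleftrightarrow> (\<forall>t\<in>{s..e}. 0 < u t \<and>
     (u has_real_derivative phi q (y t)) (at t within {s..e}) \<and>
     (y has_real_derivative - b * u t powr \<gamma>) (at t within {s..e}))"

lemma phaseD:
  assumes "phase q \<gamma> b s e u y" "t \<in> {s..e}"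
  shows "0 < u t" "(u has_real_derivative phi q (y t)) (at t within {s..e})"
    "(y has_real_derivative - b * u t powr \<gamma>) (at t within {s..e})"
  using assms by (auto simp: phase_def)

lemma phase_continuous_on:
  assumes "phase q \<gamma> b s e u y"
  shows "continuous_on {s..e} y"
  using phaseD(3)[OF assms] by (intro DERIV_continuous_on) 

lemma phase_strict_mono:
  assumes ph: "phase q \<gamma> b s e u y" and "s \<le> t" "t < t'" "t' \<le> e" "b \<noteq> 0"
  shows "b * y t' < b * y t"
proof -
  have "(y has_derivative (*) (- b * u x powr \<gamma>)) (at x within {t..t'})" if "t \<le> x" "x \<le> t'" for x
    using phaseD(3)[OF ph, of x] assms(2-4) that
    by (auto simp: has_field_derivative_def[symmetric] intro: DERIV_subset)
  then obtain x where x: "x \<in> {t<..<t'}" "y t' - y t = - b * u x powr \<gamma> * (t' - t)"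
    using mvt_simple[rule_format, OF \<open>t < t'\<close>, of y "\<lambda>x. (*) (- b * u x powr \<gamma>)"] by auto
  have "b * (y t' - y t) = - (b\<^sup>2 * u x powr \<gamma> * (t' - t))"
    unfolding x(2) by (simp add: power2_eq_square)
  moreover have "0 < b\<^sup>2 * u x powr \<gamma> * (t' - t)"
    using phaseD(1)[OF ph, of x] x(1) assms by simp
  ultimately show ?thesis by (simp add: algebra_simps)
qed

text \<open>The Hamiltonian of the planar system.\<close>

lemma phase_energy:
  assumes q: "q > 1" and n: "n = \<gamma> + 1" "n \<noteq> 0" and ph: "phase q \<gamma> b s e u y"
    and t: "t \<in> {s..e}" "t' \<in> {s..e}"
  shows "\<bar>y t\<bar> powr q / q + b * u t powr n / n = \<bar>y t'\<bar> powr q / q + b * u t' powr n / n"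
proof -
  define E where "E = (\<lambda>t. \<bar>y t\<bar> powr q / q + b * u t powr n / n)"
  have "(E has_real_derivative 0) (at t within {s..e})" if "t \<in> {s..e}" for t
  proof -
    note ph' = phaseD[OF ph that]
    have "((\<lambda>t. \<bar>y t\<bar> powr q) has_real_derivative q * phi q (y t) * (- b * u t powr \<gamma>)) (at t within {s..e})"
      using DERIV_chain2[OF has_real_derivative_abs_powr[OF q] ph'(3)] .
    moreover have "((\<lambda>t. u t powr n) has_real_derivative n * u t powr (n - 1) * phi q (y t)) (at t within {s..e})"
      using DERIV_chain2[OF has_real_derivative_powr[OF ph'(1)] ph'(2)] .
    ultimately have "(E has_real_derivative (q * phi q (y t) * (- b * u t powr \<gamma>)) / q
        + b * (n * u t powr (n - 1) * phi q (y t)) / n) (at t within {s..e})"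
      unfolding E_def by (intro DERIV_add DERIV_cdivide DERIV_cmult)
    then show ?thesis using q n by simp
  qed
  then obtain c where "\<And>t. t \<in> {s..e} \<Longrightarrow> E t = c"
    using has_field_derivative_zero_constant[of "{s..e}" E] by auto
  then show ?thesis using t by (simp add: E_def)
qed

text \<open>The conditions on the exponents in the form in which they are used: \<open>r > 0\<close> for the monotonicity of
dwell times, \<open>r q \<ge> 1\<close> for their unboundedness, and \<open>\<gamma> (q - 1) \<noteq> 1\<close>, that is \<open>\<gamma> \<noteq> p - 1\<close>, for
recovering \<open>x\<close> and \<open>Y\<close> from \<open>\<eta>\<close> and \<open>\<Lambda>\<close>.\<close>

locale exponents =
  fixes q \<gamma> n r :: real
  assumes q: "q > 1" and n: "n = \<gamma> + 1" "n \<noteq> 0" and r: "r = \<gamma> / n" "r > 0" "r * q \<ge> 1"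
    and nonresonant: "\<gamma> * (q - 1) \<noteq> 1"
begin

text \<open>Conservation of energy expresses \<open>u\<close> through \<open>v = y / Y\<close>; inserting this in \<open>y' = - b u^\<gamma>\<close> shows that
the clock reading of \<open>v\<close> is an affine function of time. The zero \<open>t1\<close> of \<open>y\<close>, where
\<open>u^n = x^n (1 + k)\<close>, is what forces \<open>k > -1\<close>.\<close>

lemma phase_profile:
  assumes ph: "phase q \<gamma> b s e u y" and b: "b \<noteq> 0"
    and t0: "t0 \<in> {s..e}" "u t0 = x" "\<bar>y t0\<bar> = Y" and Y: "Y > 0"
    and zero: "t1 \<in> {s..e}" "y t1 = 0"
    and le: "\<forall>t\<in>{s..e}. \<bar>y t\<bar> \<le> Y"
    and k: "k = n * (Y powr q / (q * x powr n)) / b"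
  shows "k > -1"
    and "t \<in> {s..e} \<Longrightarrow> u t = x * profile q k (y t / Y) powr (1 / n)"
    and "t \<in> {s..e} \<Longrightarrow> t' \<in> {s..e} \<Longrightarrow>
      clock q r k (y t' / Y) - clock q r k (y t / Y) = - (b * (x powr \<gamma> / Y) * (t' - t))"
proof -
  have x: "x > 0" using phaseD(1)[OF ph t0(1)] t0(2) by simp
  have kk: "k * x powr n = n * Y powr q / (q * b)" using x q by (simp add: k)
  have un: "u t powr n = x powr n * (1 + k * (1 - \<bar>y t / Y\<bar> powr q))" if "t \<in> {s..e}" for t
  proof -
    have "\<bar>y t\<bar> powr q / q + b * u t powr n / n = Y powr q / q + b * x powr n / n"
      using phase_energy[OF q n ph that t0(1)] t0 by simp
    then have "u t powr n = x powr n + n / (q * b) * (Y powr q - \<bar>y t\<bar> powr q)"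
      using q n(2) b by (simp add: field_simps)
    also have "n / (q * b) * (Y powr q - \<bar>y t\<bar> powr q) = (n * Y powr q / (q * b)) * (1 - \<bar>y t\<bar> powr q / Y powr q)"
      using Y q b by (simp add: field_simps)
    finally have "u t powr n = x powr n + (n * Y powr q / (q * b)) * (1 - \<bar>y t\<bar> powr q / Y powr q)" .
    then show ?thesis unfolding kk[symmetric] using Y by (simp add: algebra_simps powr_divide)
  qed
  show k1: "k > -1"
  proof -
    have "0 < u t1 powr n" using phaseD(1)[OF ph zero(1)] by simp
    then have "0 < x powr n * (1 + k)" using un[OF zero(1)] zero(2) q by simp
    then show ?thesis using x by (simp add: zero_less_mult_iff)
  qed
  have up: "u t powr n = x powr n * profile q k (y t / Y)" if "t \<in> {s..e}" for t
    using un[OF that] le[rule_format, OF that] Y by (simp add: profile_eq)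
  have upow: "u t powr a = x powr a * profile q k (y t / Y) powr (a / n)" if "t \<in> {s..e}" for t a
  proof -
    have "u t powr a = (u t powr n) powr (a / n)" using n by (simp add: powr_powr)
    also have "\<dots> = (x powr n) powr (a / n) * profile q k (y t / Y) powr (a / n)"
      unfolding up[OF that] using profile_pos[OF k1 q, of "y t / Y"] by (simp add: powr_mult)
    finally show ?thesis using n by (simp add: powr_powr)
  qed
  show "u t = x * profile q k (y t / Y) powr (1 / n)" if "t \<in> {s..e}"
    using upow[OF that, of 1] x phaseD(1)[OF ph that] by simp
  show "clock q r k (y t' / Y) - clock q r k (y t / Y) = - (b * (x powr \<gamma> / Y) * (t' - t))"
    if tt: "t \<in> {s..e}" "t' \<in> {s..e}"
  proof -
    define h where "h = (\<lambda>t. clock q r k (y t / Y) + b * (x powr \<gamma> / Y) * t)"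
    have "(h has_real_derivative 0) (at t within {s..e})" if t: "t \<in> {s..e}" for t
    proof -
      have v: "-2 < y t / Y" "y t / Y < 2" using le[rule_format, OF t] Y by (auto simp: field_simps)
      have "((\<lambda>t. y t / Y) has_real_derivative - b * u t powr \<gamma> / Y) (at t within {s..e})"
        using phaseD(3)[OF ph t] by (rule DERIV_cdivide)
      then have "((\<lambda>t. clock q r k (y t / Y)) has_real_derivative
          profile q k (y t / Y) powr - r * (- b * u t powr \<gamma> / Y)) (at t within {s..e})"
        by (rule DERIV_chain2[where f = "clock q r k" and g = "\<lambda>t. y t / Y",
              OF clock_has_real_derivative[OF q k1 v]])
      then have "(h has_real_derivative profile q k (y t / Y) powr - r * (- b * u t powr \<gamma> / Y)
          + b * (x powr \<gamma> / Y)) (at t within {s..e})"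
        unfolding h_def using Y by (auto intro!: derivative_eq_intros)
      moreover have "profile q k (y t / Y) powr - r * (- b * u t powr \<gamma> / Y) + b * (x powr \<gamma> / Y) = 0"
        unfolding upow[OF t] r(1)[symmetric] using profile_pos[OF k1 q, of "y t / Y"] Y
        by (simp add: powr_minus field_simps)
      ultimately show ?thesis by (rule DERIV_cong)
    qed
    then obtain c where "\<And>t. t \<in> {s..e} \<Longrightarrow> h t = c"
      using has_field_derivative_zero_constant[of "{s..e}" h] by auto
    from this[OF tt(1)] this[OF tt(2)] show ?thesis by (simp add: h_def algebra_simps diff_divide_distrib)
  qed
qed

text \<open>The converse of the previous computation: a function \<open>v\<close> driven by the clock equation gives a phase.\<close>

lemma phase_from_clock:
  assumes pos: "x > 0" "Y > 0" and b: "b \<noteq> 0" and k: "k = n * (Y powr q / (q * x powr n)) / b" "k > -1"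
    and v: "\<And>t. t \<in> {s..e} \<Longrightarrow> v t \<in> {-1..1}"
      "\<And>t. t \<in> {s..e} \<Longrightarrow>
        (v has_real_derivative - b * (x powr \<gamma> / Y) * profile q k (v t) powr r) (at t within {s..e})"
    and u: "\<And>t. t \<in> {s..e} \<Longrightarrow> u t = x * profile q k (v t) powr (1 / n)"
  shows "phase q \<gamma> b s e u (\<lambda>t. Y * v t)"
  unfolding phase_def
proof (intro ballI conjI)
  fix t assume t: "t \<in> {s..e}"
  define P where "P = profile q k (v t)"
  have P: "P > 0" unfolding P_def using profile_pos[OF k(2) q] .
  show "0 < u t" using P pos by (simp add: u[OF t] P_def)
  have "((\<lambda>t. Y * v t) has_real_derivative Y * (- b * (x powr \<gamma> / Y) * P powr r)) (at t within {s..e})"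
    unfolding P_def using v(2)[OF t] by (rule DERIV_cmult)
  moreover have "u t powr \<gamma> = x powr \<gamma> * P powr r"
    using pos P by (simp add: u[OF t] powr_mult powr_powr r(1) P_def)
  ultimately show "((\<lambda>t. Y * v t) has_real_derivative - b * u t powr \<gamma>) (at t within {s..e})"
    using pos by (simp add: mult.assoc)
  define Q where "Q = (\<lambda>t. 1 + k * (1 - \<bar>v t\<bar> powr q))"
  have "(Q has_real_derivative - k * (q * phi q (v t) * (- b * (x powr \<gamma> / Y) * P powr r))) (at t within {s..e})"
    unfolding Q_def P_def
    using DERIV_add[OF DERIV_const[of 1] DERIV_cmult[OF DERIV_diff[OF DERIV_const[of 1]
      DERIV_chain2[OF has_real_derivative_abs_powr[OF q] v(2)[OF t]]], of k]] by simp
  moreover have PQ: "profile q k (v t') = Q t'" if "t' \<in> {s..e}" for t'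
    using v(1)[OF that] by (simp add: Q_def profile_eq abs_le_iff)
  then have "Q t > 0" using P t by (simp add: P_def)
  ultimately have "((\<lambda>t. x * Q t powr (1 / n)) has_real_derivative
      x * (1 / n * Q t powr (1 / n - 1) * (- k * (q * phi q (v t) * (- b * (x powr \<gamma> / Y) * P powr r))))) (at t within {s..e})"
    using DERIV_cmult[OF DERIV_chain2[OF has_real_derivative_powr]] by blast
  moreover have "x * (1 / n * Q t powr (1 / n - 1) * (- k * (q * phi q (v t) * (- b * (x powr \<gamma> / Y) * P powr r))))
      = phi q (Y * v t)"
  proof -
    have e: "1 / n - 1 = - r" using n by (simp add: r(1) field_simps)
    then have "x * (1 / n * Q t powr (1 / n - 1) * (- k * (q * phi q (v t) * (- b * (x powr \<gamma> / Y) * P powr r))))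
      = (x * x powr \<gamma> / Y) * (k * b * q / n) * phi q (v t)"
      unfolding e using PQ[OF t] P by (simp add: P_def[symmetric] powr_minus field_simps)
    also have "k * b * q / n = Y powr q / x powr n" using b n q k(1) by simp
    also have "x * x powr \<gamma> = x powr n" using pos n by (simp add: powr_mult_base add.commute)
    also have "(x powr n / Y) * (Y powr q / x powr n) = Y powr (q - 1)"
      using pos by (simp add: powr_diff)
    finally show ?thesis using pos by (simp add: phi_mult)
  qed
  ultimately have "((\<lambda>t. x * Q t powr (1 / n)) has_real_derivative phi q (Y * v t)) (at t within {s..e})"
    by simp
  then show "(u has_real_derivative phi q (Y * v t)) (at t within {s..e})"
    by (rule has_field_derivative_transform_within[OF _ zero_less_one t]) (simp add: u PQ)
qed

lemma sign_exponent: "\<gamma> > 0 \<longleftrightarrow> n > 0" "\<gamma> < 0 \<longleftrightarrow> n < 0"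
  using r(1,2) n(2) by (auto simp: zero_less_divide_iff)

text \<open>In logarithmic coordinates the two equations are linear in \<open>(ln x, ln Y)\<close> with determinant
\<open>\<gamma> (q - 1) - 1\<close>.\<close>

lemma parameters_unique:
  assumes pos: "x > 0" "Y > 0" "x' > 0" "Y' > 0"
    and \<Lambda>: "x powr \<gamma> / Y = x' powr \<gamma> / Y'"
    and \<eta>: "Y powr q / (q * x powr n) = Y' powr q / (q * x' powr n)"
  shows "x = x'" "Y = Y'"
proof -
  have "ln (x powr \<gamma> / Y) = ln (x' powr \<gamma> / Y')" using \<Lambda> by simp
  then have b: "ln Y - ln Y' = \<gamma> * (ln x - ln x')" using pos by (simp add: ln_div ln_powr algebra_simps)
  have "q * (Y powr q / (q * x powr n)) = q * (Y' powr q / (q * x' powr n))" using \<eta> by simp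
  then have "ln (Y powr q / x powr n) = ln (Y' powr q / x' powr n)" using q by simp
  then have "q * (ln Y - ln Y') = n * (ln x - ln x')" using pos by (simp add: ln_div ln_powr algebra_simps)
  then have "(\<gamma> * (q - 1) - 1) * (ln x - ln x') = 0" unfolding b n by (simp add: algebra_simps)
  then have "ln x = ln x'" using nonresonant by simp
  with b have "ln Y = ln Y'" by simp
  with \<open>ln x = ln x'\<close> show "x = x'" "Y = Y'" using pos by auto
qed

lemma parameters_exist:
  assumes "\<Lambda> > 0" "\<eta> > 0"
  obtains x Y where "x > 0" "Y > 0" "x powr \<gamma> / Y = \<Lambda>" "Y powr q / (q * x powr n) = \<eta>"
proof -
  \<comment> \<open>The value of \<open>ln x\<close> that solves the linear system for \<open>(ln x, ln Y)\<close>.\<close>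
  define l where "l = (q * ln \<Lambda> + ln (q * \<eta>)) / (\<gamma> * (q - 1) - 1)"
  define x where "x = exp l"
  define Y where "Y = x powr \<gamma> / \<Lambda>"
  have pos: "x > 0" "Y > 0" using assms by (auto simp: x_def Y_def)
  have l: "(\<gamma> * (q - 1) - 1) * l = q * ln \<Lambda> + ln (q * \<eta>)" using nonresonant by (simp add: l_def)
  have "ln (Y powr q / (q * x powr n)) = q * (\<gamma> * l - ln \<Lambda>) - (ln q + n * l)"
    using pos q assms by (simp add: ln_div ln_mult ln_powr Y_def x_def)
  also have "\<dots> = ((\<gamma> * (q - 1) - 1) * l - q * ln \<Lambda>) - ln q" unfolding n by (simp add: algebra_simps)
  also have "\<dots> = ln \<eta>" unfolding l using q assms by (simp add: ln_mult)
  finally have "Y powr q / (q * x powr n) = \<eta>" using pos q assms by simp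
  moreover have "x powr \<gamma> / Y = \<Lambda>" using pos assms by (simp add: Y_def)
  ultimately show thesis using that pos by blast
qed

end

section \<open>The two-phase problem\<close>

text \<open>The parameter \<open>j\<close> is the ratio of the flux at both ends to the size of the flux at \<open>\<tau>\<close>: 0 for the
Neumann problem and 1 for the periodic one. The arguments are the same for every \<open>j\<close> in between.\<close>

locale two_phase_problem = exponents +
  fixes \<tau> T ap am j :: real
  assumes \<tau>: "0 < \<tau>" "\<tau> < T" and weights: "ap > 0" "am > 0" and j: "0 \<le> j" "j \<le> 1"
begin

definition solves :: "(real \<Rightarrow> real) \<Rightarrow> (real \<Rightarrow> real) \<Rightarrow> bool" where
  "solves u y \<longleftrightarrow> phase q \<gamma> ap 0 \<tau> u y \<and> phase q \<gamma> (- am) \<tau> T u y \<and>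
     y \<tau> < 0 \<and> y 0 = j * (- y \<tau>) \<and> y T = j * (- y \<tau>)"

text \<open>What remains of the two duration conditions once \<open>\<Lambda>\<close> is eliminated.\<close>

definition balanced :: "real \<Rightarrow> bool" where
  "balanced \<eta> \<longleftrightarrow> \<eta> > 0 \<and> n * \<eta> / ap > -1 \<and> n * \<eta> / - am > -1 \<and>
     am * (T - \<tau>) * dwell q r j (n * \<eta> / ap) = ap * \<tau> * dwell q r j (n * \<eta> / - am)"

text \<open>Applies the analysis of a single phase to both phases, with \<open>\<tau>\<close> as the common reference time. The flux
decreases on the first phase and increases on the second, so \<open>|y| \<le> Y\<close>, and it vanishes
once in each.\<close>

lemma solves_parameters:
  assumes S: "solves u y" and Y: "Y = - y \<tau>" and x: "x = u \<tau>"
    and \<eta>: "\<eta> = Y powr q / (q * x powr n)" and \<Lambda>: "\<Lambda> = x powr \<gamma> / Y"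
  shows "n * \<eta> / ap > -1" "n * \<eta> / - am > -1"
    and "dwell q r j (n * \<eta> / ap) = ap * \<Lambda> * \<tau>"
    and "dwell q r j (n * \<eta> / - am) = am * \<Lambda> * (T - \<tau>)"
    and "t \<in> {0..T} \<Longrightarrow> \<bar>y t / Y\<bar> \<le> 1"
    and "t \<in> {0..\<tau>} \<Longrightarrow> u t = x * profile q (n * \<eta> / ap) (y t / Y) powr (1 / n) \<and>
      clock q r (n * \<eta> / ap) (y t / Y) = clock q r (n * \<eta> / ap) (-1) + ap * \<Lambda> * (\<tau> - t)"
    and "t \<in> {\<tau>..T} \<Longrightarrow> u t = x * profile q (n * \<eta> / - am) (y t / Y) powr (1 / n) \<and>
      clock q r (n * \<eta> / - am) (y t / Y) = clock q r (n * \<eta> / - am) (-1) + am * \<Lambda> * (t - \<tau>)"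
proof -
  note P1 = S[unfolded solves_def, THEN conjunct1]
  note P2 = S[unfolded solves_def, THEN conjunct2, THEN conjunct1]
  have ends: "Y > 0" "y 0 = j * Y" "y \<tau> = - Y" "y T = j * Y"
    using S Y by (auto simp: solves_def)
  have jY: "0 \<le> j * Y" "j * Y \<le> Y" using j ends(1) by (auto simp: mult_left_le_one_le)
  have m1: "y t' < y t" if "0 \<le> t" "t < t'" "t' \<le> \<tau>" for t t'
    using phase_strict_mono[OF P1 that] weights by simp
  have m2: "y t < y t'" if "\<tau> \<le> t" "t < t'" "t' \<le> T" for t t'
    using phase_strict_mono[OF P2 that] weights by simp
  have le1: "\<bar>y t\<bar> \<le> Y" if "t \<in> {0..\<tau>}" for t
  proof -
    have "- Y \<le> y t" "y t \<le> j * Y"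
      using m1[of 0 t] m1[of t \<tau>] that ends jY by (cases "t = 0"; cases "t = \<tau>"; force)+
    then show ?thesis using jY by linarith
  qed
  have le2: "\<bar>y t\<bar> \<le> Y" if "t \<in> {\<tau>..T}" for t
  proof -
    have "- Y \<le> y t" "y t \<le> j * Y"
      using m2[of \<tau> t] m2[of t T] that ends jY by (cases "t = \<tau>"; cases "t = T"; force)+
    then show ?thesis using jY by linarith
  qed
  obtain t1 where t1: "t1 \<in> {0..\<tau>}" "y t1 = 0"
    using IVT2'[of y \<tau> 0 0] phase_continuous_on[OF P1] ends jY \<tau> by auto
  obtain t2 where t2: "t2 \<in> {\<tau>..T}" "y t2 = 0"
    using IVT'[of y \<tau> 0 T] phase_continuous_on[OF P2] ends jY \<tau> by auto
  have k: "n * \<eta> / ap = n * (Y powr q / (q * x powr n)) / ap"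
    "n * \<eta> / - am = n * (Y powr q / (q * x powr n)) / - am" by (simp_all add: \<eta>)
  have mem: "\<tau> \<in> {0..\<tau>}" "\<tau> \<in> {\<tau>..T}" "0 \<in> {0..\<tau>}" "T \<in> {\<tau>..T}" using \<tau> by auto
  have abs: "\<bar>y \<tau>\<bar> = Y" using ends by simp
  have nz: "ap \<noteq> 0" "- am \<noteq> 0" using weights by auto
  have le1': "\<forall>t\<in>{0..\<tau>}. \<bar>y t\<bar> \<le> Y" and le2': "\<forall>t\<in>{\<tau>..T}. \<bar>y t\<bar> \<le> Y"
    using le1 le2 by blast+
  note R1 = phase_profile[OF P1 nz(1) mem(1) x[symmetric] abs ends(1) t1 le1' k(1)]
  note R2 = phase_profile[OF P2 nz(2) mem(2) x[symmetric] abs ends(1) t2 le2' k(2)]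
  show "n * \<eta> / ap > -1" "n * \<eta> / - am > -1" using R1(1) R2(1) by auto
  show "\<bar>y t / Y\<bar> \<le> 1" if "t \<in> {0..T}"
    using le1[of t] le2[of t] that ends(1) by (cases "t \<le> \<tau>") (auto simp: abs_divide)
  have C1: "clock q r (n * \<eta> / ap) (y t / Y) = clock q r (n * \<eta> / ap) (-1) + ap * \<Lambda> * (\<tau> - t)"
    if "t \<in> {0..\<tau>}" for t
    using R1(3)[OF that mem(1)] ends \<Lambda> by simp
  have C2: "clock q r (n * \<eta> / - am) (y t / Y) = clock q r (n * \<eta> / - am) (-1) + am * \<Lambda> * (t - \<tau>)"
    if "t \<in> {\<tau>..T}" for t
    using R2(3)[OF mem(2) that] ends \<Lambda> by simp
  show "u t = x * profile q (n * \<eta> / ap) (y t / Y) powr (1 / n) \<and>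
      clock q r (n * \<eta> / ap) (y t / Y) = clock q r (n * \<eta> / ap) (-1) + ap * \<Lambda> * (\<tau> - t)"
    if "t \<in> {0..\<tau>}" using R1(2)[OF that] C1[OF that] by blast
  show "u t = x * profile q (n * \<eta> / - am) (y t / Y) powr (1 / n) \<and>
      clock q r (n * \<eta> / - am) (y t / Y) = clock q r (n * \<eta> / - am) (-1) + am * \<Lambda> * (t - \<tau>)"
    if "t \<in> {\<tau>..T}" using R2(2)[OF that] C2[OF that] by blast
  show "dwell q r j (n * \<eta> / ap) = ap * \<Lambda> * \<tau>"
    using C1[OF mem(3)] ends by (simp add: dwell_def)
  show "dwell q r j (n * \<eta> / - am) = am * \<Lambda> * (T - \<tau>)"
    using C2[OF mem(4)] ends by (simp add: dwell_def)
qed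

lemma solves_balanced:
  assumes S: "solves u y"
  shows "balanced ((- y \<tau>) powr q / (q * u \<tau> powr n))"
proof -
  have "y \<tau> < 0" "u \<tau> > 0" using S \<tau> by (auto simp: solves_def phase_def)
  then show ?thesis
    using solves_parameters(1-4)[OF S refl refl refl refl] q by (simp add: balanced_def)
qed

lemma dwell_less_iff:
  assumes "k > -1" "k' > -1"
  shows "dwell q r j k < dwell q r j k' \<longleftrightarrow> k' < k"
  using assms j dwell_strict_antimono[OF q r(2), of j k k'] dwell_strict_antimono[OF q r(2), of j k' k]
  by (cases k k' rule: linorder_cases) auto

text \<open>As \<open>\<eta>\<close> increases, one of \<open>n \<eta> / ap\<close> and \<open>- n \<eta> / am\<close> increases and the other decreases, so the two
sides of the balance condition move in opposite directions.\<close>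

lemma not_balanced_less:
  assumes B: "balanced \<eta>" "balanced \<eta>'" and less: "\<eta> < \<eta>'"
  shows False
proof -
  have w: "am * (T - \<tau>) > 0" "ap * \<tau> > 0" using weights \<tau> by auto
  let ?p = "\<lambda>\<eta>. dwell q r j (n * \<eta> / ap)" and ?m = "\<lambda>\<eta>. dwell q r j (n * \<eta> / - am)"
  have cmp: "?p \<eta>' < ?p \<eta> \<longleftrightarrow> n * \<eta> / ap < n * \<eta>' / ap" "?p \<eta> < ?p \<eta>' \<longleftrightarrow> n * \<eta>' / ap < n * \<eta> / ap"
    "?m \<eta>' < ?m \<eta> \<longleftrightarrow> n * \<eta> / - am < n * \<eta>' / - am" "?m \<eta> < ?m \<eta>' \<longleftrightarrow> n * \<eta>' / - am < n * \<eta> / - am"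
    using B by (auto simp only: balanced_def intro!: dwell_less_iff)
  have "?p \<eta>' < ?p \<eta> \<and> ?m \<eta> < ?m \<eta>' \<or> ?p \<eta> < ?p \<eta>' \<and> ?m \<eta>' < ?m \<eta>"
    unfolding cmp using less weights n(2) by (cases "n > 0") (auto simp: divide_strict_right_mono)
  then have "am * (T - \<tau>) * ?p \<eta>' < am * (T - \<tau>) * ?p \<eta> \<and> ap * \<tau> * ?m \<eta> < ap * \<tau> * ?m \<eta>' \<or>
      am * (T - \<tau>) * ?p \<eta> < am * (T - \<tau>) * ?p \<eta>' \<and> ap * \<tau> * ?m \<eta>' < ap * \<tau> * ?m \<eta>"
    using w by (simp only: mult_less_cancel_left_pos)
  then show False using B unfolding balanced_def by linarith
qed

text \<open>The two arguments have opposite signs, so one dwell time lies above its value at 0 and the other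
below; which is which depends on the sign of \<open>n\<close>, which is that of \<open>\<gamma>\<close>.\<close>

lemma balanced_sign:
  assumes B: "balanced \<eta>"
  shows "\<gamma> * (ap * \<tau> - am * (T - \<tau>)) < 0"
proof -
  let ?p = "dwell q r j (n * \<eta> / ap)" and ?m = "dwell q r j (n * \<eta> / - am)"
  have w: "am * (T - \<tau>) > 0" "ap * \<tau> > 0" using weights \<tau> by auto
  have k: "n * \<eta> / ap > -1" "n * \<eta> / - am > -1" "\<eta> > 0"
    and eq: "am * (T - \<tau>) * ?p = ap * \<tau> * ?m" using B by (auto simp: balanced_def)
  have pos: "?p > 0" "?m > 0" using k j by (auto intro!: dwell_pos q)
  consider "n > 0" | "n < 0" using n(2) by linarith
  then show ?thesis
  proof cases
    case 1
    then have "0 < n * \<eta> / ap" "n * \<eta> / - am < 0" using k weights by auto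
    then have "?p < ?m" using dwell_less_iff[OF k(1,2)] by linarith
    then have "ap * \<tau> * ?p < am * (T - \<tau>) * ?p" using w eq by (metis mult_strict_left_mono)
    then have "ap * \<tau> < am * (T - \<tau>)" using pos by simp
    then show ?thesis using 1 sign_exponent by (intro mult_pos_neg) auto
  next
    case 2
    then have "n * \<eta> / ap < 0" "0 < n * \<eta> / - am" using k weights by (auto simp: divide_neg_pos mult_neg_pos)
    then have "?m < ?p" using dwell_less_iff[OF k(2,1)] by linarith
    then have "am * (T - \<tau>) * ?p < ap * \<tau> * ?p" using w eq by (metis mult_strict_left_mono)
    then have "am * (T - \<tau>) < ap * \<tau>" using pos by simp
    then show ?thesis using 2 sign_exponent by (intro mult_neg_pos) auto
  qed
qed

lemma balanced_exists:
  assumes sign: "\<gamma> * (ap * \<tau> - am * (T - \<tau>)) < 0"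
  obtains \<eta> where "balanced \<eta>"
proof -
  have w: "am * (T - \<tau>) > 0" "ap * \<tau> > 0" using weights \<tau> by auto
  consider "n > 0" | "n < 0" using n(2) by linarith
  then show thesis
  proof cases
    case 1
    then have "ap * \<tau> < am * (T - \<tau>)" using sign sign_exponent by (simp add: mult_less_0_iff)
    then obtain \<kappa> where \<kappa>: "0 < \<kappa>" "\<kappa> < am"
      "ap * \<tau> * dwell q r j (- \<kappa> / am) = am * (T - \<tau>) * dwell q r j (\<kappa> / ap)"
      using dwell_balance[OF q r(2,3) j w(2) _ weights] by blast
    \<comment> \<open>The phase with positive \<open>k\<close> is the first one if \<open>n > 0\<close> and the second one if \<open>n < 0\<close>.\<close>
    have "balanced (\<kappa> / n)"
      using 1 \<kappa> weights by (auto simp: balanced_def field_simps add_pos_pos)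
    then show thesis by (rule that)
  next
    case 2
    then have "am * (T - \<tau>) < ap * \<tau>" using sign sign_exponent by (simp add: mult_less_0_iff)
    then obtain \<kappa> where \<kappa>: "0 < \<kappa>" "\<kappa> < ap"
      "am * (T - \<tau>) * dwell q r j (- \<kappa> / ap) = ap * \<tau> * dwell q r j (\<kappa> / am)"
      using dwell_balance[OF q r(2,3) j w(1) _ weights(2,1)] by blast
    have "n * (- \<kappa> / n) = - \<kappa>" using n(2) by simp
    moreover have "- \<kappa> / n > 0" using 2 \<kappa> by (simp add: divide_pos_neg)
    ultimately have "balanced (- \<kappa> / n)"
      using \<kappa> weights by (simp add: balanced_def field_simps)
    then show thesis by (rule that)
  qed
qed

lemma solves_unique:
  assumes S: "solves u y" and S': "solves u' y'" and t: "t \<in> {0..T}"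
  shows "u t = u' t"
proof -
  define Y where "Y = - y \<tau>"
  define Y' where "Y' = - y' \<tau>"
  define x where "x = u \<tau>"
  define x' where "x' = u' \<tau>"
  define \<eta> where "\<eta> = Y powr q / (q * x powr n)"
  define \<Lambda> where "\<Lambda> = x powr \<gamma> / Y"
  have pos: "x > 0" "Y > 0" "x' > 0" "Y' > 0"
    using S S' \<tau> by (auto simp: solves_def phase_def x_def Y_def x'_def Y'_def)
  \<comment> \<open>Both solutions yield balanced values, so neither can be smaller.\<close>
  have \<eta>': "\<eta> = Y' powr q / (q * x' powr n)"
    using not_balanced_less[OF solves_balanced[OF S] solves_balanced[OF S']]
      not_balanced_less[OF solves_balanced[OF S'] solves_balanced[OF S]]
    unfolding \<eta>_def Y_def x_def Y'_def x'_def by (metis linorder_neqE)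
  note R = solves_parameters[OF S Y_def x_def \<eta>_def \<Lambda>_def]
  note R0 = solves_parameters[OF S' Y'_def x'_def \<eta>' refl]
  have "(ap * \<tau>) * \<Lambda> = (ap * \<tau>) * (x' powr \<gamma> / Y')" using R(3) R0(3) by (simp add: mult_ac)
  then have \<Lambda>': "\<Lambda> = x' powr \<gamma> / Y'" using weights \<tau> by (simp only: mult_cancel_left) auto
  note R' = solves_parameters[OF S' Y'_def x'_def \<eta>' \<Lambda>']
  have xY: "x' = x" "Y' = Y"
    using parameters_unique[OF pos] \<Lambda>_def \<Lambda>' \<eta>_def \<eta>' by auto
  have inj: "v = v'" if "\<bar>v\<bar> \<le> 1" "\<bar>v'\<bar> \<le> 1" "clock q r k v = clock q r k v'" "k > -1" for k v v'
    using that clock_strict_mono[OF q \<open>k > -1\<close>, of v v' r] clock_strict_mono[OF q \<open>k > -1\<close>, of v' v r]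
    by (cases v v' rule: linorder_cases) (auto simp: abs_le_iff)
  show ?thesis
  proof (cases "t \<le> \<tau>")
    case True
    then have t1: "t \<in> {0..\<tau>}" using t by simp
    have "y t / Y = y' t / Y'"
      using inj[OF R(5)[OF t] R'(5)[OF t] _ R(1)] R(6)[OF t1] R'(6)[OF t1] by simp
    then show ?thesis
      unfolding R(6)[OF t1, THEN conjunct1] R'(6)[OF t1, THEN conjunct1] xY
      using pos by simp
  next
    case False
    then have t2: "t \<in> {\<tau>..T}" using t by simp
    have "y t / Y = y' t / Y'"
      using inj[OF R(5)[OF t] R'(5)[OF t] _ R(2)] R(7)[OF t2] R'(7)[OF t2] by simp
    then show ?thesis
      unfolding R(7)[OF t2, THEN conjunct1] R'(7)[OF t2, THEN conjunct1] xY
      using pos by simp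
  qed
qed

text \<open>A balanced \<open>\<eta>\<close> fixes \<open>\<Lambda>\<close>, hence \<open>x\<close> and \<open>Y\<close>; each phase then follows the inverse of its clock, started
so that both reach \<open>v = -1\<close> at time \<open>\<tau>\<close>.\<close>

lemma solves_exists:
  assumes sign: "\<gamma> * (ap * \<tau> - am * (T - \<tau>)) < 0"
  obtains u y where "solves u y"
proof -
  obtain \<eta> where B: "balanced \<eta>" using balanced_exists[OF sign] .
  define kp where "kp = n * \<eta> / ap"
  define km where "km = n * \<eta> / - am"
  define \<Lambda> where "\<Lambda> = dwell q r j kp / (ap * \<tau>)"
  have \<eta>: "\<eta> > 0" and kp: "kp > -1" and km: "km > -1"
    using B by (auto simp: balanced_def kp_def km_def)
  have \<Lambda>: "\<Lambda> > 0" using dwell_pos[OF q kp, of j] j weights \<tau> by (simp add: \<Lambda>_def)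
  have dp: "dwell q r j kp = ap * \<Lambda> * \<tau>" using weights \<tau> by (simp add: \<Lambda>_def)
  have dm: "dwell q r j km = am * \<Lambda> * (T - \<tau>)"
    using B weights \<tau> by (simp add: \<Lambda>_def balanced_def kp_def km_def field_simps)
  obtain x Y where xY: "x > 0" "Y > 0" "x powr \<gamma> / Y = \<Lambda>" "Y powr q / (q * x powr n) = \<eta>"
    using parameters_exist[OF \<Lambda> \<eta>] .
  obtain N where N: "\<And>z. z \<in> {-1..1} \<Longrightarrow> N (clock q r kp z) = z"
    "\<And>s. s \<in> {clock q r kp (-1)..clock q r kp 1} \<Longrightarrow> N s \<in> {-1..1} \<and> clock q r kp (N s) = s \<and>
           (N has_real_derivative profile q kp (N s) powr r) (at s)"
    using clock_inverse[OF q kp, of r] by metis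
  obtain M where M: "\<And>z. z \<in> {-1..1} \<Longrightarrow> M (clock q r km z) = z"
    "\<And>s. s \<in> {clock q r km (-1)..clock q r km 1} \<Longrightarrow> M s \<in> {-1..1} \<and> clock q r km (M s) = s \<and>
           (M has_real_derivative profile q km (M s) powr r) (at s)"
    using clock_inverse[OF q km, of r] by metis
  define v1 where "v1 = (\<lambda>t. N (clock q r kp (-1) + ap * \<Lambda> * (\<tau> - t)))"
  define v2 where "v2 = (\<lambda>t. M (clock q r km (-1) + am * \<Lambda> * (t - \<tau>)))"
  define v where "v = (\<lambda>t. if t \<le> \<tau> then v1 t else v2 t)"
  define u where "u = (\<lambda>t. x * profile q (if t \<le> \<tau> then kp else km) (v t) powr (1 / n))"
  have le1: "clock q r k j \<le> clock q r k 1" if "k > -1" for k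
    using clock_strict_mono[OF q that, of j 1 r] j by (cases "j = 1") auto
  have s1: "clock q r kp (-1) + ap * \<Lambda> * (\<tau> - t) \<in> {clock q r kp (-1)..clock q r kp 1}"
    if t: "t \<in> {0..\<tau>}" for t
  proof -
    have "0 \<le> ap * \<Lambda> * (\<tau> - t)" "ap * \<Lambda> * (\<tau> - t) \<le> ap * \<Lambda> * \<tau>"
      using t weights \<Lambda> by (auto intro!: mult_left_mono)
    then show ?thesis using dp le1[OF kp] unfolding dwell_def by auto
  qed
  have s2: "clock q r km (-1) + am * \<Lambda> * (t - \<tau>) \<in> {clock q r km (-1)..clock q r km 1}"
    if t: "t \<in> {\<tau>..T}" for t
  proof -
    have "0 \<le> am * \<Lambda> * (t - \<tau>)" "am * \<Lambda> * (t - \<tau>) \<le> am * \<Lambda> * (T - \<tau>)"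
      using t weights \<Lambda> by (auto intro!: mult_left_mono)
    then show ?thesis using dm le1[OF km] unfolding dwell_def by auto
  qed
  have D1: "(v1 has_real_derivative - ap * (x powr \<gamma> / Y) * profile q kp (v1 t) powr r) (at t within {0..\<tau>})"
    if "t \<in> {0..\<tau>}" for t
  proof -
    have "((\<lambda>t. clock q r kp (-1) + ap * \<Lambda> * (\<tau> - t)) has_real_derivative - (ap * \<Lambda>)) (at t within {0..\<tau>})"
      by (auto intro!: derivative_eq_intros)
    from DERIV_chain2[OF N(2)[OF s1[OF that], THEN conjunct2, THEN conjunct2] this]
    show ?thesis by (simp add: v1_def xY(3) mult_ac)
  qed
  have D2: "(v2 has_real_derivative - (- am) * (x powr \<gamma> / Y) * profile q km (v2 t) powr r) (at t within {\<tau>..T})"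
    if "t \<in> {\<tau>..T}" for t
  proof -
    have "((\<lambda>t. clock q r km (-1) + am * \<Lambda> * (t - \<tau>)) has_real_derivative (am * \<Lambda>)) (at t within {\<tau>..T})"
      by (auto intro!: derivative_eq_intros)
    from DERIV_chain2[OF M(2)[OF s2[OF that], THEN conjunct2, THEN conjunct2] this]
    show ?thesis by (simp add: v2_def xY(3) mult_ac)
  qed
  have at_\<tau>: "v1 \<tau> = -1" "v2 \<tau> = -1" using N(1)[of "-1"] M(1)[of "-1"] by (simp_all add: v1_def v2_def)
  have vv: "v t = v1 t" if "t \<in> {0..\<tau>}" for t using that by (simp add: v_def)
  have vv2: "v t = v2 t" if "t \<in> {\<tau>..T}" for t
    using that at_\<tau> by (cases "t = \<tau>") (auto simp: v_def)
  \<comment> \<open>At \<open>\<tau>\<close> both formulas give \<open>u = x\<close>, because the profile at \<open>v = -1\<close> is 1 for every \<open>k\<close>.\<close>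
  have uu2: "u t = x * profile q km (v t) powr (1 / n)" if "t \<in> {\<tau>..T}" for t
  proof (cases "t = \<tau>")
    case True
    then show ?thesis using at_\<tau> by (simp add: u_def vv2 v_def profile_def)
  qed (use that in \<open>simp add: u_def\<close>)
  have nz: "ap \<noteq> 0" "- am \<noteq> 0" using weights by auto
  have k: "kp = n * (Y powr q / (q * x powr n)) / ap" "km = n * (Y powr q / (q * x powr n)) / - am"
    using xY(4) by (simp_all add: kp_def km_def)
  have "phase q \<gamma> ap 0 \<tau> u (\<lambda>t. Y * v t)"
  proof (rule phase_from_clock[OF xY(1,2) nz(1) k(1) kp])
    show "v t \<in> {-1..1}" if "t \<in> {0..\<tau>}" for t
      using N(2)[OF s1[OF that]] that by (simp add: v_def v1_def)
    show "(v has_real_derivative - ap * (x powr \<gamma> / Y) * profile q kp (v t) powr r) (at t within {0..\<tau>})"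
      if t: "t \<in> {0..\<tau>}" for t
      unfolding vv[OF t] by (rule has_field_derivative_transform_within[OF D1[OF t] zero_less_one t]) (simp add: vv)
  qed (simp add: u_def)
  moreover have "phase q \<gamma> (- am) \<tau> T u (\<lambda>t. Y * v t)"
  proof (rule phase_from_clock[OF xY(1,2) nz(2) k(2) km])
    show "v t \<in> {-1..1}" if "t \<in> {\<tau>..T}" for t
      using M(2)[OF s2[OF that]] that by (simp add: vv2 v2_def)
    show "(v has_real_derivative - (- am) * (x powr \<gamma> / Y) * profile q km (v t) powr r) (at t within {\<tau>..T})"
      if t: "t \<in> {\<tau>..T}" for t
      unfolding vv2[OF t] by (rule has_field_derivative_transform_within[OF D2[OF t] zero_less_one t]) (simp add: vv2)
  qed (simp add: uu2)
  moreover have "v 0 = j"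
    using N(1)[of j] j \<tau> by (simp add: v_def v1_def flip: dp) (simp add: dwell_def)
  moreover have "v T = j"
    using M(1)[of j] j \<tau> by (simp add: v_def v2_def flip: dm) (simp add: dwell_def)
  moreover have "v \<tau> = -1" using at_\<tau> by (simp add: v_def)
  ultimately have "solves u (\<lambda>t. Y * v t)" using xY(2) by (simp add: solves_def)
  then show thesis by (rule that)
qed

end

section \<open>From weak solutions to phases and back\<close>

lemma has_real_derivative_within_join:
  fixes f :: "real \<Rightarrow> real"
  assumes m: "a \<le> m" "m \<le> b"
    and l: "t \<in> {a..m} \<Longrightarrow> (f has_real_derivative D) (at t within {a..m})"
    and r: "t \<in> {m..b} \<Longrightarrow> (f has_real_derivative D) (at t within {m..b})"
    and t: "t \<in> {a..b}"
  shows "(f has_real_derivative D) (at t within {a..b})"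
proof -
  consider "t < m" | "t > m" | "t = m" by linarith
  then show ?thesis
  proof cases
    case 1
    then have "at t within {a..b} = at t within {a..m}"
      using m by (intro at_within_nhd[of _ "{..<m}"]) auto
    then show ?thesis using l t 1 by simp
  next
    case 2
    then have "at t within {a..b} = at t within {m..b}"
      using m by (intro at_within_nhd[of _ "{m<..}"]) auto
    then show ?thesis using r t 2 by simp
  next
    case 3
    have "{a..b} = {a..m} \<union> {m..b}" using m by auto
    then show ?thesis
      using l r 3 m by (simp add: has_field_derivative_iff Lim_within_Un)
  qed
qed

text \<open>Since \<open>u\<close> is continuous, the almost everywhere derivative of the flux agrees with a continuous
function on each phase, and absolute continuity upgrades this to differentiability everywhere.
The value of \<open>a\<close> at the right end \<open>e\<close>, where it jumps or is unspecified, is absorbed in the null set.\<close>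

lemma positive_solution_imp_phase:
  assumes sol: "positive_solution p \<gamma> a T u u'" and pq: "(p - 1) * (q - 1) = 1"
    and sub: "0 \<le> s" "s \<le> e" "e \<le> T" and a: "\<And>t. s \<le> t \<Longrightarrow> t < e \<Longrightarrow> a t = b"
  shows "phase q \<gamma> b s e u (\<lambda>t. phi p (u' t))"
proof -
  let ?y = "\<lambda>t. phi p (u' t)"
  from sol have pos: "\<And>t. t \<in> {0..T} \<Longrightarrow> u t > 0"
    and du: "\<And>t. t \<in> {0..T} \<Longrightarrow> (u has_real_derivative u' t) (at t within {0..T})"
    and ac: "absolutely_continuous_fun_on ?y {0..T}"
    and ode: "AE t in lebesgue_on {0..T}. \<exists>D. (?y has_real_derivative D) (at t within {0..T}) \<and>
        D + a t * u t powr \<gamma> = 0"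
    by (auto simp: positive_solution_def)
  have sub': "{s..e} \<subseteq> {0..T}" using sub by auto
  have du': "(u has_real_derivative u' t) (at t within {s..e})" if "t \<in> {s..e}" for t
    using du that sub' by (meson DERIV_subset subsetD)
  have "continuous_on {s..e} u" using du' by (rule DERIV_continuous_on)
  then have cont: "continuous_on {s..e} (\<lambda>t. - b * u t powr \<gamma>)"
    using pos sub' by (intro continuous_intros) (auto simp: subset_iff less_imp_neq[symmetric])
  from ode have "\<exists>N. negligible N \<and> {t. \<not> (t \<in> {0..T} \<longrightarrow>
      (\<exists>D. (?y has_real_derivative D) (at t within {0..T}) \<and> D + a t * u t powr \<gamma> = 0))} \<subseteq> N"
    by (simp add: AE_restrict_space_iff eventually_ae_filter_negligible)
  then obtain N where N: "negligible N" "\<And>t. t \<in> {0..T} - N \<Longrightarrow>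
      \<exists>D. (?y has_real_derivative D) (at t within {0..T}) \<and> D + a t * u t powr \<gamma> = 0"
    by blast
  have N': "negligible (insert e N)" using N(1) by simp
  have dy: "(?y has_real_derivative - b * u t powr \<gamma>) (at t within {s..e})"
    if t: "t \<in> {s..e} - insert e N" for t
  proof -
    have t': "t \<in> {0..T} - N" "a t = b" using t sub' a by auto
    obtain D where D: "(?y has_real_derivative D) (at t within {0..T})" "D + a t * u t powr \<gamma> = 0"
      using N(2)[OF t'(1)] by blast
    have "D = - b * u t powr \<gamma>" using D(2) t'(2) by simp
    then show ?thesis using DERIV_subset[OF D(1) sub'] by simp
  qed
  have inv: "phi q (?y t) = u' t" for t
    using pq by (intro phi_phi) (simp add: mult.commute)
  show ?thesis
    unfolding phase_def
  proof (intro ballI conjI)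
    fix t assume t: "t \<in> {s..e}"
    show "0 < u t" using pos t sub' by auto
    show "(u has_real_derivative phi q (?y t)) (at t within {s..e})" using du'[OF t] by (simp add: inv)
    show "(?y has_real_derivative - b * u t powr \<gamma>) (at t within {s..e})"
      using absolutely_continuous_has_real_derivative[OF
          absolutely_continuous_fun_on_subset[OF ac sub'] cont N' dy t] .
  qed
qed

lemma phase_Lipschitz:
  assumes ph: "phase q \<gamma> b s e u y" and "s \<le> e"
  obtains L where "L \<ge> 0" "\<And>t t'. t \<in> {s..e} \<Longrightarrow> t' \<in> {s..e} \<Longrightarrow> \<bar>y t' - y t\<bar> \<le> L * \<bar>t' - t\<bar>"
proof -
  have "continuous_on {s..e} u" using phaseD(2)[OF ph] by (rule DERIV_continuous_on)
  then have cont: "continuous_on {s..e} (\<lambda>t. - b * u t powr \<gamma>)"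
    using phaseD(1)[OF ph] by (intro continuous_intros) (auto simp: less_imp_neq[symmetric])
  then have "bounded ((\<lambda>t. - b * u t powr \<gamma>) ` {s..e})"
    by (intro compact_imp_bounded compact_continuous_image) auto
  then obtain L where L: "L > 0" "\<And>t. t \<in> {s..e} \<Longrightarrow> \<bar>- b * u t powr \<gamma>\<bar> \<le> L"
    unfolding bounded_pos by auto
  show thesis
  proof (rule that[of L])
    show "\<bar>y t' - y t\<bar> \<le> L * \<bar>t' - t\<bar>" if "t \<in> {s..e}" "t' \<in> {s..e}" for t t'
      using field_differentiable_bound[of "{s..e}" y "\<lambda>t. - b * u t powr \<gamma>" L t' t] phaseD(3)[OF ph] L(2) that
      by auto
  qed (use L in auto)
qed

text \<open>The flux is Lipschitz on both phases, hence absolutely continuous. Its derivative jumps at \<open>\<tau>\<close>, and \<open>a\<close>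
is unspecified at \<open>T\<close>, so the equation is only claimed outside these two points.\<close>

lemma phases_imp_positive_solution:
  assumes ph1: "phase q \<gamma> ap 0 \<tau> u y" and ph2: "phase q \<gamma> (- am) \<tau> T u y"
    and pq: "(p - 1) * (q - 1) = 1" "q > 1" and \<tau>: "0 < \<tau>" "\<tau> < T"
    and ap: "\<And>t. t \<in> {0..<\<tau>} \<Longrightarrow> a t = ap" and am: "\<And>t. t \<in> {\<tau>..<T} \<Longrightarrow> a t = - am"
    and u: "u \<in> {0..T} \<rightarrow>\<^sub>E {0<..}"
  shows "positive_solution p \<gamma> a T u (\<lambda>t. phi q (y t))"
proof -
  have y_cont: "continuous_on {0..T} y"
    using continuous_on_closed_Un[of "{0..\<tau>}" "{\<tau>..T}" y] phase_continuous_on[OF ph1] phase_continuous_on[OF ph2] \<tau>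
    by (simp add: ivl_disj_un_two_touch)
  have du: "(u has_real_derivative phi q (y t)) (at t within {0..T})" if "t \<in> {0..T}" for t
    using \<tau> phaseD(2)[OF ph1, of t] phaseD(2)[OF ph2, of t] that
    by (intro has_real_derivative_within_join[of 0 \<tau> T]) auto
  obtain L1 where L1: "L1 \<ge> 0" "\<And>t t'. t \<in> {0..\<tau>} \<Longrightarrow> t' \<in> {0..\<tau>} \<Longrightarrow> \<bar>y t' - y t\<bar> \<le> L1 * \<bar>t' - t\<bar>"
    using phase_Lipschitz[OF ph1] \<tau> by auto
  obtain L2 where L2: "L2 \<ge> 0" "\<And>t t'. t \<in> {\<tau>..T} \<Longrightarrow> t' \<in> {\<tau>..T} \<Longrightarrow> \<bar>y t' - y t\<bar> \<le> L2 * \<bar>t' - t\<bar>"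
    using phase_Lipschitz[OF ph2] \<tau> by auto
  have Lle: "\<bar>y t' - y t\<bar> \<le> (L1 + L2) * (t' - t)" if "0 \<le> t" "t \<le> t'" "t' \<le> T" for t t'
  proof -
    consider "t' \<le> \<tau>" | "\<tau> \<le> t" | "t < \<tau>" "\<tau> < t'" by linarith
    then show ?thesis
    proof cases
      case 1
      then show ?thesis using L1(2)[of t t'] mult_nonneg_nonneg[OF L2(1), of "t' - t"] that
        by (simp add: distrib_right)
    next
      case 2
      then show ?thesis using L2(2)[of t t'] mult_nonneg_nonneg[OF L1(1), of "t' - t"] that
        by (simp add: distrib_right)
    next
      case 3
      have "\<bar>y t' - y t\<bar> \<le> L1 * (\<tau> - t) + L2 * (t' - \<tau>)"
        using L1(2)[of t \<tau>] L2(2)[of \<tau> t'] 3 that \<tau> by simp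
      also have "\<dots> \<le> L1 * (t' - t) + L2 * (t' - t)"
        using 3 L1(1) L2(1) by (intro add_mono mult_left_mono) auto
      finally show ?thesis by (simp add: distrib_right)
    qed
  qed
  have ac: "absolutely_continuous_fun_on y {0..T}"
  proof (rule Lipschitz_imp_absolutely_continuous_fun_on[where L = "L1 + L2"])
    show "\<bar>y t' - y t\<bar> \<le> (L1 + L2) * \<bar>t' - t\<bar>" if "t \<in> {0..T}" "t' \<in> {0..T}" for t t'
      using Lle[of t t'] Lle[of t' t] that by (cases "t \<le> t'") (auto simp: abs_minus_commute)
  qed
  have ode: "\<exists>D. (y has_real_derivative D) (at t within {0..T}) \<and> D + a t * u t powr \<gamma> = 0"
    if t: "t \<in> {0..T} - {\<tau>, T}" for t
  proof (cases "t < \<tau>")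
    case True
    then have "(y has_real_derivative - ap * u t powr \<gamma>) (at t within {0..T})"
      using t \<tau> phaseD(3)[OF ph1, of t] by (intro has_real_derivative_within_join[of 0 \<tau> T]) auto
    then show ?thesis using ap[of t] t True by (intro exI[of _ "- ap * u t powr \<gamma>"]) auto
  next
    case False
    then have "(y has_real_derivative am * u t powr \<gamma>) (at t within {0..T})"
      using t \<tau> phaseD(3)[OF ph2, of t] by (intro has_real_derivative_within_join[of 0 \<tau> T]) auto
    then show ?thesis using am[of t] t False by (intro exI[of _ "am * u t powr \<gamma>"]) auto
  qed
  have "AE t in lebesgue_on {0..T}. \<exists>D. (y has_real_derivative D) (at t within {0..T}) \<and> D + a t * u t powr \<gamma> = 0"
    using ode by (auto simp: AE_restrict_space_iff eventually_ae_filter_negligible intro!: exI[of _ "{\<tau>, T}"])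
  moreover have "continuous_on {0..T} (\<lambda>t. phi q (y t))"
    using continuous_on_compose2[OF continuous_on_phi[OF pq(2)] y_cont] by blast
  ultimately show ?thesis
    unfolding positive_solution_def phi_phi[OF pq(1)] using u du ac by simp
qed

lemma phase_cong:
  assumes "phase q \<gamma> b s e u y" and "\<And>t. t \<in> {s..e} \<Longrightarrow> u t = u' t"
  shows "phase q \<gamma> b s e u' y"
  unfolding phase_def
proof (intro ballI conjI)
  fix t assume t: "t \<in> {s..e}"
  note ph = phaseD[OF assms(1) t]
  show "0 < u' t" "(y has_real_derivative - b * u' t powr \<gamma>) (at t within {s..e})"
    using ph assms(2)[OF t] by auto
  show "(u' has_real_derivative phi q (y t)) (at t within {s..e})"
    using has_field_derivative_transform_within[OF ph(2) zero_less_one t] assms(2) by blast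
qed

text \<open>Zero boundary slope means zero boundary flux, which is \<open>j = 0\<close>; that \<open>y(\<tau>) < 0\<close> is automatic
because \<open>y\<close> decreases on \<open>[0,\<tau>]\<close>.\<close>

lemma neumann_iff_solves:
  assumes "two_phase_problem q \<gamma> n r \<tau> T ap am 0" and pq: "(p - 1) * (q - 1) = 1"
    and ap: "\<And>t. t \<in> {0..<\<tau>} \<Longrightarrow> a t = ap" and am: "\<And>t. t \<in> {\<tau>..<T} \<Longrightarrow> a t = - am"
  shows "neumann_positive_solution p \<gamma> a T u \<longleftrightarrow>
    u \<in> {0..T} \<rightarrow>\<^sub>E {0<..} \<and> (\<exists>y. two_phase_problem.solves q \<gamma> \<tau> T ap am 0 u y)"
proof -
  interpret two_phase_problem q \<gamma> n r \<tau> T ap am 0 by fact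
  show ?thesis
  proof (intro iffI conjI; (elim conjE)?)
    assume "neumann_positive_solution p \<gamma> a T u"
    then obtain u' where sol: "positive_solution p \<gamma> a T u u'" and bc: "u' 0 = 0" "u' T = 0"
      by (auto simp: neumann_positive_solution_def)
    show "u \<in> {0..T} \<rightarrow>\<^sub>E {0<..}" using sol by (simp add: positive_solution_def)
    have ph: "phase q \<gamma> ap 0 \<tau> u (\<lambda>t. phi p (u' t))" "phase q \<gamma> (- am) \<tau> T u (\<lambda>t. phi p (u' t))"
      using \<tau> ap am by (auto intro!: positive_solution_imp_phase[OF sol pq])
    have "phi p (u' \<tau>) < phi p (u' 0)"
      using phase_strict_mono[OF ph(1), of 0 \<tau>] \<tau> weights by simp
    then show "\<exists>y. solves u y"
      using ph bc by (intro exI[of _ "\<lambda>t. phi p (u' t)"]) (simp add: solves_def phi_def)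
  next
    assume u: "u \<in> {0..T} \<rightarrow>\<^sub>E {0<..}" and "\<exists>y. solves u y"
    then obtain y where S: "solves u y" by blast
    then have "positive_solution p \<gamma> a T u (\<lambda>t. phi q (y t))"
      using phases_imp_positive_solution[OF _ _ pq q \<tau> ap am u] by (simp add: solves_def)
    then show "neumann_positive_solution p \<gamma> a T u"
      using S unfolding neumann_positive_solution_def
      by (intro exI[of _ "\<lambda>t. phi q (y t)"]) (simp add: solves_def phi_def)
  qed
qed

text \<open>Periodicity gives equal flux at both ends but says nothing about its size. The two energy
identities have weights of opposite sign, so subtracting one from the other leaves
\<open>(ap + am) u(0)^n = (ap + am) u(\<tau>)^n\<close>. Hence \<open>|y(0)| = |y(\<tau>)|\<close>, and since \<open>y\<close> decreases on \<open>[0,\<tau>]\<close>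
this leaves \<open>y(0) = - y(\<tau>) > 0\<close>, which is \<open>j = 1\<close>. Conversely, \<open>|y|\<close> is the same at \<open>0\<close>, \<open>\<tau>\<close> and \<open>T\<close>, so by
conservation of energy \<open>u\<close> is too.\<close>

lemma periodic_iff_solves:
  assumes "two_phase_problem q \<gamma> n r \<tau> T ap am 1" and pq: "(p - 1) * (q - 1) = 1"
    and ap: "\<And>t. t \<in> {0..<\<tau>} \<Longrightarrow> a t = ap" and am: "\<And>t. t \<in> {\<tau>..<T} \<Longrightarrow> a t = - am"
  shows "periodic_positive_solution p \<gamma> a T u \<longleftrightarrow>
    u \<in> {0..T} \<rightarrow>\<^sub>E {0<..} \<and> (\<exists>y. two_phase_problem.solves q \<gamma> \<tau> T ap am 1 u y)"
proof -
  interpret two_phase_problem q \<gamma> n r \<tau> T ap am 1 by fact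
  have energy: "\<bar>y 0\<bar> powr q / q + ap * (u 0 powr n / n) = \<bar>y \<tau>\<bar> powr q / q + ap * (u \<tau> powr n / n)"
    "\<bar>y T\<bar> powr q / q - am * (u T powr n / n) = \<bar>y \<tau>\<bar> powr q / q - am * (u \<tau> powr n / n)"
    if "phase q \<gamma> ap 0 \<tau> u y" "phase q \<gamma> (- am) \<tau> T u y" for y
    using phase_energy[OF q n that(1), of 0 \<tau>] phase_energy[OF q n that(2), of T \<tau>] \<tau> by auto
  show ?thesis
  proof (intro iffI conjI; (elim conjE)?)
    assume "periodic_positive_solution p \<gamma> a T u"
    then obtain u' where sol: "positive_solution p \<gamma> a T u u'" and bc: "u 0 = u T" "u' 0 = u' T"
      by (auto simp: periodic_positive_solution_def)
    define y where "y = (\<lambda>t. phi p (u' t))"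
    show "u \<in> {0..T} \<rightarrow>\<^sub>E {0<..}" using sol by (simp add: positive_solution_def)
    have ph: "phase q \<gamma> ap 0 \<tau> u y" "phase q \<gamma> (- am) \<tau> T u y"
      unfolding y_def using \<tau> ap am by (auto intro!: positive_solution_imp_phase[OF sol pq])
    have less: "y \<tau> < y 0"
      using phase_strict_mono[OF ph(1), of 0 \<tau>] \<tau> weights by simp
    have y0T: "y T = y 0" using bc by (simp add: y_def)
    have "(ap + am) * (u 0 powr n / n) = (ap + am) * (u \<tau> powr n / n)"
      using energy[OF ph] unfolding y0T bc(1)[symmetric] distrib_right by linarith
    then have "u 0 powr n / n = u \<tau> powr n / n" using weights by simp
    then have "\<bar>y 0\<bar> powr q = \<bar>y \<tau>\<bar> powr q" using energy(1)[OF ph] q n(2) by simp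
    then have "(\<bar>y 0\<bar> powr q) powr (1 / q) = (\<bar>y \<tau>\<bar> powr q) powr (1 / q)" by simp
    then have "\<bar>y 0\<bar> = \<bar>y \<tau>\<bar>" using q by (simp add: powr_powr)
    then have "y \<tau> < 0" "y 0 = - y \<tau>" using less by auto
    then show "\<exists>y. solves u y"
      using ph y0T by (intro exI[of _ y]) (simp add: solves_def)
  next
    assume u: "u \<in> {0..T} \<rightarrow>\<^sub>E {0<..}" and "\<exists>y. solves u y"
    then obtain y where S: "solves u y" by blast
    then have ph: "phase q \<gamma> ap 0 \<tau> u y" "phase q \<gamma> (- am) \<tau> T u y" and y: "y 0 = - y \<tau>" "y T = - y \<tau>"
      by (auto simp: solves_def)
    have "u 0 powr n = u T powr n" using energy[OF ph] y weights n(2) by simp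
    moreover have "u 0 > 0" "u T > 0" using phaseD(1)[OF ph(1), of 0] phaseD(1)[OF ph(2), of T] \<tau> by auto
    ultimately have "u 0 = u T" using n(2) by (metis powr_powr powr_one order_less_imp_le right_inverse)
    moreover have "positive_solution p \<gamma> a T u (\<lambda>t. phi q (y t))"
      by (rule phases_imp_positive_solution[OF ph pq q \<tau> ap am u])
    ultimately show "periodic_positive_solution p \<gamma> a T u"
      using y unfolding periodic_positive_solution_def
      by (intro exI[of _ "\<lambda>t. phi q (y t)"]) simp
  qed
qed

section \<open>Uniqueness and existence for both boundary conditions\<close>

lemma (in two_phase_problem) unique_and_exists_iff:
  assumes prob: "\<And>u. P u \<longleftrightarrow> u \<in> {0..T} \<rightarrow>\<^sub>E {0<..} \<and> (\<exists>y. solves u y)"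
  shows "\<exists>\<^sub>\<le>\<^sub>1u. P u" and "(\<exists>!u. P u) \<longleftrightarrow> \<gamma> * (ap * \<tau> - am * (T - \<tau>)) < 0"
proof -
  have uniq: "u = u'" if "P u" "P u'" for u u'
  proof (rule PiE_ext)
    show "u \<in> {0..T} \<rightarrow>\<^sub>E {0<..}" "u' \<in> {0..T} \<rightarrow>\<^sub>E {0<..}" using that prob by blast+
    show "u t = u' t" if "t \<in> {0..T}" for t
      using \<open>P u\<close> \<open>P u'\<close> prob solves_unique that by blast
  qed
  then show "\<exists>\<^sub>\<le>\<^sub>1u. P u" by (simp add: Uniq_def)
  have "(\<exists>u. P u) \<longleftrightarrow> \<gamma> * (ap * \<tau> - am * (T - \<tau>)) < 0"
  proof
    assume "\<exists>u. P u"
    then show "\<gamma> * (ap * \<tau> - am * (T - \<tau>)) < 0"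
      using prob solves_balanced balanced_sign by blast
  next
    assume "\<gamma> * (ap * \<tau> - am * (T - \<tau>)) < 0"
    then obtain u y where S: "solves u y" by (rule solves_exists)
    define w where "w = restrict u {0..T}"
    have eq: "u t = w t" if "t \<in> {0..T}" for t using that by (simp add: w_def)
    have ph: "phase q \<gamma> ap 0 \<tau> u y" "phase q \<gamma> (- am) \<tau> T u y" using S by (auto simp: solves_def)
    have "phase q \<gamma> ap 0 \<tau> w y" "phase q \<gamma> (- am) \<tau> T w y"
      using phase_cong[OF ph(1)] phase_cong[OF ph(2)] eq \<tau> by auto
    then have "solves w y" using S by (simp add: solves_def)
    moreover have "u t > 0" if "t \<in> {0..T}" for t
      using phaseD(1)[OF ph(1), of t] phaseD(1)[OF ph(2), of t] that by (cases "t \<le> \<tau>") auto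
    then have "w \<in> {0..T} \<rightarrow>\<^sub>E {0<..}" by (auto simp: w_def)
    ultimately show "\<exists>u. P u" using prob by blast
  qed
  then show "(\<exists>!u. P u) \<longleftrightarrow> \<gamma> * (ap * \<tau> - am * (T - \<tau>)) < 0" using uniq by metis
qed

lemma integral_stepwise:
  fixes a :: "real \<Rightarrow> real"
  assumes "0 < \<tau>" "\<tau> < T"
    and ap: "\<And>t. t \<in> {0..<\<tau>} \<Longrightarrow> a t = ap" and am: "\<And>t. t \<in> {\<tau>..<T} \<Longrightarrow> a t = - am"
  shows "(LBINT t:{0..T}. a t) = ap * \<tau> - am * (T - \<tau>)"
proof -
  have "indicat_real {0..T} t *\<^sub>R a t =
      ap * indicat_real {0..<\<tau>} t - am * indicat_real {\<tau>..<T} t + a T * indicat_real {T} t" for t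
    using assms by (cases "t < \<tau>"; cases "t = T") (auto simp: indicator_def)
  then show ?thesis
    using assms by (simp add: set_lebesgue_integral_def)
qed

text \<open>For \<open>\<gamma> > p - 1\<close>, \<open>r q \<ge> 1\<close> amounts to \<open>\<gamma> (q - 1) \<ge> 1\<close>. On the other range \<open>\<gamma> < -2\<close>, where already
\<open>r > 1\<close>.\<close>

lemma exponents_of_range:
  assumes p: "p > 1" and \<gamma>: "\<gamma> \<in> {..(1 - 2 * p) / (p - 1)} \<union> {p - 1<..}"
  shows "exponents (p / (p - 1)) \<gamma> (\<gamma> + 1) (\<gamma> / (\<gamma> + 1))"
proof
  have q1: "p / (p - 1) - 1 = 1 / (p - 1)" using p by (simp add: field_simps)
  show "p / (p - 1) > 1" using p by simp
  consider "\<gamma> > p - 1" | "\<gamma> < -2"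
  proof (cases "\<gamma> > p - 1")
    case False
    then have "\<gamma> * (p - 1) \<le> 1 - 2 * p" using \<gamma> p by (simp add: pos_le_divide_eq)
    then have "(\<gamma> + 2) * (p - 1) < 0" by (simp add: algebra_simps)
    then have "\<gamma> < -2" using p by (simp add: mult_less_0_iff)
    then show thesis by (rule that)
  qed (use that in auto)
  then have "\<gamma> + 1 \<noteq> 0 \<and> \<gamma> / (\<gamma> + 1) > 0 \<and> \<gamma> / (\<gamma> + 1) * (p / (p - 1)) \<ge> 1 \<and> \<gamma> * (1 / (p - 1)) \<noteq> 1"
  proof cases
    case 1
    then have "\<gamma> * p \<ge> (\<gamma> + 1) * (p - 1)" by (simp add: algebra_simps)
    moreover have "0 < (\<gamma> + 1) * (p - 1)" using 1 p by simp
    ultimately have "1 \<le> \<gamma> * p / ((\<gamma> + 1) * (p - 1))" by (simp only: pos_le_divide_eq)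
    then show ?thesis using 1 p by (simp add: divide_eq_eq)
  next
    case 2
    then have "\<gamma> / (\<gamma> + 1) \<ge> 1" by (simp add: neg_le_divide_eq)
    moreover have "p / (p - 1) \<ge> 1" using p by simp
    ultimately have "1 * 1 \<le> \<gamma> / (\<gamma> + 1) * (p / (p - 1))" by (intro mult_mono) auto
    then show ?thesis using 2 p by (auto simp: zero_less_divide_iff field_simps)
  qed
  then show "\<gamma> + 1 \<noteq> 0" "\<gamma> / (\<gamma> + 1) > 0" "\<gamma> / (\<gamma> + 1) * (p / (p - 1)) \<ge> 1"
    "\<gamma> * (p / (p - 1) - 1) \<noteq> 1" unfolding q1 by blast+
qed (rule refl)+

theorem theorem1p2:
  fixes \<tau> T a_plus a_minus p \<gamma> :: real
    and a :: "real \<Rightarrow> real"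
  assumes "0 < \<tau>" and "\<tau> < T"
    and "a_plus > 0" and "a_minus > 0"
    and "\<And>t. t \<in> {0..<\<tau>} \<Longrightarrow> a t = a_plus"
    and "\<And>t. t \<in> {\<tau>..<T} \<Longrightarrow> a t = - a_minus"
    and "p > 1"
    and "\<gamma> \<in> {..(1 - 2 * p) / (p - 1)} \<union> {p - 1<..}"
  shows "(\<exists>\<^sub>\<le>\<^sub>1u. neumann_positive_solution p \<gamma> a T u) \<and>
    (\<exists>\<^sub>\<le>\<^sub>1u. periodic_positive_solution p \<gamma> a T u) \<and>
    ((\<exists>!u. neumann_positive_solution p \<gamma> a T u) \<longleftrightarrow> \<gamma> * (LBINT t:{0..T}. a t) < 0) \<and>
    ((\<exists>!u. periodic_positive_solution p \<gamma> a T u) \<longleftrightarrow> \<gamma> * (LBINT t:{0..T}. a t) < 0)"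
proof -
  define q n r where "q = p / (p - 1)" and "n = \<gamma> + 1" and "r = \<gamma> / n"
  interpret exponents q \<gamma> n r
    using exponents_of_range[OF assms(7,8)] by (simp add: q_def n_def r_def)
  interpret N: two_phase_problem q \<gamma> n r \<tau> T a_plus a_minus 0 by unfold_locales (use assms in auto)
  interpret P: two_phase_problem q \<gamma> n r \<tau> T a_plus a_minus 1 by unfold_locales (use assms in auto)
  have pq: "(p - 1) * (q - 1) = 1" using assms(7) by (simp add: q_def field_simps)
  note neumann = neumann_iff_solves[OF N.two_phase_problem_axioms pq assms(5,6)]
  note periodic = periodic_iff_solves[OF P.two_phase_problem_axioms pq assms(5,6)]
  have "(LBINT t:{0..T}. a t) = a_plus * \<tau> - a_minus * (T - \<tau>)"
    by (rule integral_stepwise[OF assms(1,2,5,6)])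
  then show ?thesis
    using N.unique_and_exists_iff[of "neumann_positive_solution p \<gamma> a T", OF neumann]
      P.unique_and_exists_iff[of "periodic_positive_solution p \<gamma> a T", OF periodic] by simp
qed

end
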